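(* Let $N>0$ be an integer and let $s>t\ge 10$ be relatively prime integers. (i) There exists a unique solution $y>0$ to the equation $$\frac{-b_1(s,t,y)}{2st\,y^{2}}=N.$$ (ii) For this value of $y$, $$\bar{p}_{s,t}(N)= \frac{y^{3/2}\sqrt{2st}\,\exp\left(2\pi Ny\right)H(iy,s,t)}{\sqrt{b_2(s,t,y)}}\left(1+O\left(y\right)\right),$$ where the implied constant is absolute.
   Context: An overpartition of $N$ is a partition of $N$ in which the first occurrence of each distinct part may be overlined. $\bar p_{s,t}(N)$ is the number of overpartitions of $N$ none of whose parts is divisible by $s$ or by $t$ (with $\bar p_{s,t}(0)=1$). For $z=x+iy$ with $y>0$, $\eta(z)=e^{\pi i z/12}\prod_{n\ge1}(1-e^{2\pi i n z})$ is the Dedekind eta function, and $$H(z,s,t)=\frac{\eta(2z)\,\eta(2stz)\,\eta(sz)^{2}\,\eta(tz)^{2}}{\eta(z)^{2}\,\eta(stz)^{2}\,\eta(2sz)\,\eta(2tz)},$$ which equals $\sum_{N\ge0}\bar p_{s,t}(N)q^N$ with $q=e^{2\pi i z}$ when $\gcd(s,t)=1$. For integers $k\ge1$ and $z$ in the upper half-plane, $$\mu_k(z)=-\frac{z^{k+1}}{2\pi i}\left(\frac{d}{dz}\right)^{k}\log\eta(z).$$ For $y>0$, $$b_k(s,t,y)= 4st\,\mu_k(iy)+4\mu_k(stiy)+t\,\mu_k(2siy)+s\,\mu_k(2tiy)-st\,\mu_{k}(2iy)-\mu_k(2stiy)-4t\,\mu_k(siy)-4s\,\mu_k(tiy),$$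 where $\mu_k(miy)$ means $\mu_k$ evaluated at the point $m\cdot iy$. *)

theory Defs
  imports "HOL-Complex_Analysis.Complex_Analysis" "HOL-Library.Multiset"
begin

text \<open>An overpartition is encoded as a pair \<open>(M, S)\<close>: the multiset \<open>M\<close> of its parts and the
  set \<open>S\<close> of those part sizes whose first occurrence is overlined.\<close>

definition overpartitions :: "nat \<Rightarrow> (nat multiset \<times> nat set) set" where
  "overpartitions N = {(M, S). 0 \<notin># M \<and> sum_mset M = N \<and> S \<subseteq> set_mset M}"

definition pbar :: "nat \<Rightarrow> nat \<Rightarrow> nat \<Rightarrow> nat" where
  "pbar s t N = card {(M, S) \<in> overpartitions N. \<forall>m\<in>#M. \<not> s dvd m \<and> \<not> t dvd m}"

lemma size_le_sum_mset: "0 \<notin># M \<Longrightarrow> size M \<le> sum_mset (M :: nat multiset)"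
  by (induction M) auto

lemma finite_overpartitions: "finite (overpartitions N)"
proof -
  have "overpartitions N \<subseteq> (mset ` {xs. set xs \<subseteq> {..N} \<and> length xs \<le> N}) \<times> Pow {..N}"
  proof
    fix p assume "p \<in> overpartitions N"
    then obtain M S where p: "p = (M, S)" and M: "0 \<notin># M" "sum_mset M = N" and S: "S \<subseteq> set_mset M"
      by (auto simp: overpartitions_def)
    obtain xs where xs: "M = mset xs" by (metis ex_mset)
    have "length xs \<le> N" using size_le_sum_mset[OF M(1)] M(2) xs by simp
    have le: "m \<le> N" if "m \<in># M" for m
    proof -
      from that obtain M' where "M = add_mset m M'" by (meson mset_add)
      then show ?thesis using M(2) by simp
    qed
    have SN: "set_mset M \<subseteq> {..N}" using le by blast
    have "M \<in> mset ` {xs. set xs \<subseteq> {..N} \<and> length xs \<le> N}"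
      using xs SN \<open>length xs \<le> N\<close> by (intro image_eqI[of _ _ xs]) simp_all
    moreover have "S \<in> Pow {..N}" using S SN by blast
    ultimately show "p \<in> (mset ` {xs. set xs \<subseteq> {..N} \<and> length xs \<le> N}) \<times> Pow {..N}"
      unfolding p by (rule SigmaI)
  qed
  moreover have "finite ((mset ` {xs. set xs \<subseteq> {..N} \<and> length xs \<le> N}) \<times> Pow {..N})"
    by (intro finite_cartesian_product finite_imageI finite_lists_length_le) simp_all
  ultimately show ?thesis
    by (rule finite_subset)
qed

lemma pbar_0: "pbar s t 0 = 1"
proof -
  have "{(M, S) \<in> overpartitions 0. \<forall>m\<in>#M. \<not> s dvd m \<and> \<not> t dvd m} = {({#}, {})}"
  proof -
    have "M = {#}" if "0 \<notin># M" "sum_mset M = 0" for M :: "nat multiset"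
      using size_le_sum_mset[OF that(1)] that(2) by simp
    then show ?thesis by (auto simp: overpartitions_def)
  qed
  then show ?thesis by (simp add: pbar_def)
qed

definition dedekind_eta :: "complex \<Rightarrow> complex" where
  "dedekind_eta z = exp (pi * \<i> * z / 12) * (\<Prod>n. 1 - exp (2 * pi * \<i> * of_nat (Suc n) * z))"

text \<open>The holomorphic branch of \<open>log \<eta>\<close> on the upper half-plane that is real on the imaginary axis.
  The principal value \<open>Ln (dedekind_eta z)\<close> would be discontinuous wherever \<open>\<eta>\<close> crosses the
  negative real axis; here every factor \<open>1 - q\<^sup>n\<close> has positive real part.\<close>

definition log_eta :: "complex \<Rightarrow> complex" where
  "log_eta z = pi * \<i> * z / 12 + (\<Sum>n. Ln (1 - exp (2 * pi * \<i> * of_nat (Suc n) * z)))"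

lemma exp_log_eta:
  assumes "Im z > 0"
  shows "exp (log_eta z) = dedekind_eta z"
proof -
  define q where "q = exp (2 * pi * \<i> * z)"
  have qn: "exp (2 * pi * \<i> * of_nat (Suc n) * z) = q ^ Suc n" for n
    unfolding q_def exp_of_nat_mult[symmetric] by (simp add: algebra_simps)
  have q1: "norm q < 1"
    using assms by (simp add: q_def norm_exp_eq_Re)
  have qlt: "norm (q ^ Suc n) < 1" for n
    using q1 power_less_one_iff[of "norm q" "Suc n"] by (simp only: norm_power norm_ge_zero zero_less_Suc)
  then have nz: "1 - q ^ Suc n \<noteq> 0" for n
    using qlt[of n] by (metis eq_iff_diff_eq_0 less_irrefl norm_one)
  have "summable (\<lambda>n. norm (q ^ Suc n))"
    using q1 by (simp add: norm_mult norm_power summable_mult summable_geometric)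
  moreover have "norm (1 - q ^ Suc n - 1) = norm (q ^ Suc n)" for n
    by (metis add_diff_cancel_left' diff_add_cancel norm_minus_commute)
  ultimately have "summable (\<lambda>n. norm (1 - q ^ Suc n - 1))"
    by (simp only:)
  then have cp: "convergent_prod (\<lambda>n. 1 - q ^ Suc n)"
    by (intro abs_convergent_prod_imp_convergent_prod summable_imp_abs_convergent_prod)
  have "summable (\<lambda>n. Ln (1 - q ^ Suc n))"
    by (rule summable_Ln_complex[OF cp nz])
  then have "(\<Prod>n. exp (Ln (1 - q ^ Suc n))) = exp (\<Sum>n. Ln (1 - q ^ Suc n))"
    by (rule prodinf_exp)
  then have "(\<Prod>n. 1 - q ^ Suc n) = exp (\<Sum>n. Ln (1 - q ^ Suc n))"
    by (simp only: exp_Ln[OF nz])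
  then show ?thesis
    unfolding log_eta_def dedekind_eta_def qn exp_add by (simp only:)
qed

definition mu :: "nat \<Rightarrow> complex \<Rightarrow> complex" where
  "mu k z = - (z ^ (k + 1) / (2 * pi * \<i>)) * (deriv ^^ k) log_eta z"

definition H :: "complex \<Rightarrow> nat \<Rightarrow> nat \<Rightarrow> complex" where
  "H z s t =
     (dedekind_eta (2 * z) * dedekind_eta (2 * s * t * z)
        * (dedekind_eta (s * z))\<^sup>2 * (dedekind_eta (t * z))\<^sup>2)
   / ((dedekind_eta z)\<^sup>2 * (dedekind_eta (s * t * z))\<^sup>2
        * dedekind_eta (2 * s * z) * dedekind_eta (2 * t * z))"

definition b :: "nat \<Rightarrow> nat \<Rightarrow> nat \<Rightarrow> real \<Rightarrow> complex" where
  "b k s t y =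
     (let \<mu> = (\<lambda>m :: nat. mu k (of_nat m * (\<i> * y))) in
        4 * s * t * \<mu> 1 + 4 * \<mu> (s * t) + t * \<mu> (2 * s) + s * \<mu> (2 * t)
      - s * t * \<mu> 2 - \<mu> (2 * s * t) - 4 * t * \<mu> s - 4 * s * \<mu> t)"

end

theory Submission
  imports Defs "HOL-Probability.Probability"
begin

text \<open>
  Write \<open>q = exp (2 \<pi> \<i> z)\<close>. The generating function of \<open>pbar s t\<close> is \<open>\<Prod>n. (1 + q ^ n) / (1 - q ^ n)\<close> over the \<open>n\<close>
  divisible by neither \<open>s\<close> nor \<open>t\<close>, and its logarithm is \<open>\<Sum>m. log_coeff s t m * q ^ m\<close> with nonnegative
  coefficients. Expanding \<open>log \<eta>\<close> as the Lambert series \<open>\<pi> \<i> z / 12 - (\<Sum>m. sigma_inv m * q ^ m)\<close> identifies this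
  function with \<open>H\<close> and identifies \<open>b 1\<close> and \<open>b 2\<close>, up to elementary factors, with the first and second moments
  \<open>moment j s t y = (\<Sum>m. m ^ j * log_coeff s t m * exp (- 2 \<pi> y m))\<close>.

  The equation for \<open>y\<close> now reads \<open>moment 1 s t y = N\<close>. As the coefficients are nonnegative, the left-hand side
  decreases strictly from infinity to \<open>0\<close>, so there is exactly one solution (lemma \<open>ex1_saddle_point\<close>). It is the
  saddle point of \<open>H z * exp (- 2 \<pi> \<i> N z)\<close> on the imaginary axis.

  The asymptotic formula is the Laplace method for Cauchy's coefficient integral over the circle of radius
  \<open>exp (- 2 \<pi> y)\<close>. It needs three facts that are uniform in \<open>s\<close> and \<open>t\<close>.

  \<^item> The \<open>j\<close>-th moment is at most a constant times \<open>y\<close> to the power \<open>- (j + 1)\<close> (lemma \<open>moment_le\<close>).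

  \<^item> Away from the positive real axis the integrand is small: at an angle \<open>\<theta>\<close> that is at least of order \<open>y\<close>, it is smaller
    than at \<open>\<theta> = 0\<close> by a factor \<open>exp (- c / y)\<close> (lemma \<open>cosine_deficit_ge\<close>). Up to a factor, the exponent is the
    sum of \<open>r ^ m * (1 - cos (m \<theta>))\<close> over the allowed \<open>m\<close>. Over all integers this sum is an explicit rational function of \<open>r\<close>
    and \<open>1 - cos \<theta>\<close>; over the multiples of \<open>s\<close> it is at most \<open>1 / (1 + r + \<dots> + r ^ (s - 1))\<close> times as large,
    at every angle (lemma \<open>cosine_kernel_dilate_le\<close>). For \<open>s, t \<ge> 10\<close> and small \<open>y\<close> the forbidden
    integers therefore take away at most half.

  \<^item> The second moment is at least a constant times \<open>y\<close> to the power \<open>- 3\<close> (lemma \<open>moment_2_ge\<close>). This is the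
    previous estimate at the angle \<open>\<theta> = y\<close>.

  Near the saddle point the third and fourth moments control the Taylor expansion of the exponent. The cubic term
  is purely imaginary, so after taking real parts it contributes only through its square, and the
  error relative to the Gaussian is of order \<open>y\<close> (lemma \<open>gaussian_approximation_near_saddle\<close>). When \<open>y\<close> is
  bounded away from \<open>0\<close>, an error of order \<open>y\<close> says only that the ratio to the main term is bounded, and
  that follows from the nonnegativity of the coefficients of the generating function.
\<close>

section \<open>Power series with coefficients of polynomial growth\<close>

lemma power_div_fact_le_exp:
  assumes "x \<ge> (0::real)" shows "x ^ k / fact k \<le> exp x"
proof -
  have "x ^ k / fact k \<le> (\<Sum>n<Suc k. x ^ n / fact n)"
    using assms by (simp add: sum_nonneg)
  also have "\<dots> \<le> (\<Sum>n. x ^ n / fact n)"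
    using assms summable_exp[of x] by (intro sum_le_suminf) (auto simp: field_simps)
  also have "\<dots> = exp x" by (simp add: exp_def divide_inverse mult.commute)
  finally show ?thesis .
qed

text \<open>Half of the exponential decay absorbs any power: this is the exponential series, which bounds
  \<open>(v * x) ^ k / fact k\<close> by \<open>exp (v * x)\<close>.\<close>

lemma power_times_exp_le:
  assumes "x \<ge> (0::real)" "v > 0"
  shows "x ^ k * exp (- 2 * v * x) \<le> fact k / v ^ k * exp (- v * x)"
proof -
  have "(v * x) ^ k \<le> fact k * exp (v * x)"
    using power_div_fact_le_exp[of "v * x" k] assms by (simp add: field_simps)
  then have "x ^ k \<le> fact k / v ^ k * exp (v * x)"
    using assms by (simp add: field_simps power_mult_distrib)
  then have "x ^ k * exp (- 2 * v * x) \<le> fact k / v ^ k * exp (v * x) * exp (- 2 * v * x)"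
    by (intro mult_right_mono) auto
  also have "\<dots> = fact k / v ^ k * (exp (v * x) * exp (- 2 * v * x))" by simp
  also have "exp (v * x) * exp (- 2 * v * x) = exp (- v * x)"
    unfolding exp_add[symmetric] by (simp add: algebra_simps)
  finally show ?thesis .
qed

text \<open>Real coefficients with an argument in any field over the reals, so that the same series can be
  differentiated at complex arguments and estimated at real ones.\<close>

definition power_sum :: "(nat \<Rightarrow> real) \<Rightarrow> 'a::{real_normed_field,banach} \<Rightarrow> 'a" where
  "power_sum c x = (\<Sum>m. of_real (c m) * x ^ m)"

definition poly_growth :: "(nat \<Rightarrow> real) \<Rightarrow> bool" where
  "poly_growth c \<longleftrightarrow> (\<exists>C k. \<forall>m. \<bar>c m\<bar> \<le> C * (real m + 1) ^ k)"

lemma poly_growthI: "(\<And>m. \<bar>c m\<bar> \<le> C * (real m + 1) ^ k) \<Longrightarrow> poly_growth c"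
  by (auto simp: poly_growth_def)

lemma poly_growth_power_times:
  assumes "poly_growth c" shows "poly_growth (\<lambda>m. real m ^ j * c m)"
proof -
  obtain C k where c: "\<And>m. \<bar>c m\<bar> \<le> C * (real m + 1) ^ k"
    using assms by (auto simp: poly_growth_def)
  show ?thesis
  proof (rule poly_growthI[of _ C "j + k"])
    fix m
    have "\<bar>real m ^ j * c m\<bar> \<le> (real m + 1) ^ j * (C * (real m + 1) ^ k)"
      unfolding abs_mult by (intro mult_mono c) (auto intro: power_mono)
    then show "\<bar>real m ^ j * c m\<bar> \<le> C * (real m + 1) ^ (j + k)"
      by (simp add: power_add mult_ac)
  qed
qed

lemma summable_power_sum:
  fixes x :: "'a::{real_normed_field,banach}"
  assumes "poly_growth c" "norm x < 1"
  shows "summable (\<lambda>m. norm (of_real (c m) * x ^ m))"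
proof (cases "x = 0")
  case True
  then show ?thesis by (intro summable_finite[of "{0}"]) auto
next
  case False
  obtain C k where c: "\<And>m. \<bar>c m\<bar> \<le> C * (real m + 1) ^ k"
    using assms by (auto simp: poly_growth_def)
  have C: "C \<ge> 0" using c[of 0] by auto
  define v where "v = - ln (norm x) / 2"
  have v: "v > 0" "norm x = exp (- 2 * v)" using False assms by (auto simp: v_def)
  have "summable (\<lambda>m. (C * exp (2 * v) * (fact k / v ^ k) * exp (- v)) * exp (- v) ^ m)"
    using v by (intro summable_mult summable_geometric) auto
  then show ?thesis
  proof (rule summable_comparison_test')
    fix m :: nat
    have "norm (of_real (c m) * x ^ m) = \<bar>c m\<bar> * exp (- 2 * v * real m)"
      by (simp add: norm_mult norm_power v(2) exp_of_nat_mult[symmetric] mult_ac)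
    also have "\<dots> \<le> (C * (real m + 1) ^ k) * exp (- 2 * v * real m)"
      by (intro mult_right_mono c) auto
    also have "\<dots> = C * exp (2 * v) * ((real m + 1) ^ k * exp (- 2 * v * (real m + 1)))"
      by (simp add: algebra_simps flip: exp_add)
    also have "\<dots> \<le> C * exp (2 * v) * (fact k / v ^ k * exp (- v * (real m + 1)))"
      using C v by (intro mult_left_mono power_times_exp_le) auto
    also have "\<dots> = (C * exp (2 * v) * (fact k / v ^ k) * exp (- v)) * exp (- v) ^ m"
      by (simp add: algebra_simps exp_of_nat_mult[symmetric] flip: exp_add)
    finally show "norm (norm (of_real (c m) * x ^ m)) \<le> (C * exp (2 * v) * (fact k / v ^ k) * exp (- v)) * exp (- v) ^ m"
      by simp
  qed
qed

lemmas summable_power_sum' = summable_norm_cancel[OF summable_power_sum]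

lemma power_sum_of_real: "poly_growth c \<Longrightarrow> \<bar>x\<bar> < 1 \<Longrightarrow> power_sum c (complex_of_real x) = of_real (power_sum c x)"
  using summable_power_sum'[of c x] unfolding power_sum_def
  by (subst suminf_of_real) auto

lemma power_sum_deriv:
  fixes x :: "'a::{real_normed_field,banach}"
  assumes "poly_growth c" "norm x < 1"
  shows "(power_sum c has_field_derivative power_sum (\<lambda>m. real (Suc m) * c (Suc m)) x) (at x)"
  using termdiffs_strong'[OF summable_power_sum'[OF assms(1)] assms(2)]
  by (simp add: diffs_def power_sum_def[abs_def])

lemma power_sum_times_index:
  fixes x :: "'a::{real_normed_field,banach}"
  assumes "poly_growth c" "norm x < 1"
  shows "power_sum (\<lambda>m. real m * c m) x = x * power_sum (\<lambda>m. real (Suc m) * c (Suc m)) x"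
proof -
  have s: "summable (\<lambda>m. of_real (real m * c m) * x ^ m)"
    using summable_power_sum'[OF poly_growth_power_times[OF assms(1), of 1] assms(2)] by simp
  have "power_sum (\<lambda>m. real m * c m) x = (\<Sum>m. of_real (real (Suc m) * c (Suc m)) * x ^ Suc m)"
    using suminf_split_head[OF s] unfolding power_sum_def by simp
  also have "\<dots> = x * power_sum (\<lambda>m. real (Suc m) * c (Suc m)) x"
  proof (cases "x = 0")
    case False
    have "summable (\<lambda>m. of_real (real (Suc m) * c (Suc m)) * x ^ Suc m)"
      using s by (subst summable_Suc_iff)
    then have "summable (\<lambda>m. x * (of_real (real (Suc m) * c (Suc m)) * x ^ m))"
      by (simp only: power_Suc mult_ac)
    then have "summable (\<lambda>m. of_real (real (Suc m) * c (Suc m)) * x ^ m)"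
      using False by (rule summable_mult_D)
    then show ?thesis unfolding power_sum_def
      by (subst suminf_mult[symmetric]) (auto simp: mult_ac)
  qed simp
  finally show ?thesis .
qed

lemma norm_exp_2pi_i: "Im z > 0 \<Longrightarrow> norm (exp (2 * pi * \<i> * z)) < 1"
  by simp

text \<open>In the variable \<open>z\<close> with \<open>q = exp (2 \<pi> \<i> z)\<close>, differentiation multiplies the \<open>m\<close>-th coefficient
  by \<open>2 \<pi> \<i> m\<close>. Iterating it turns derivatives of \<open>log \<eta>\<close> into moments of its coefficients.\<close>

lemma power_sum_exp_deriv:
  assumes "poly_growth c" "Im z > 0"
  shows "((\<lambda>z. power_sum c (exp (2 * pi * \<i> * z))) has_field_derivative
     2 * pi * \<i> * power_sum (\<lambda>m. real m * c m) (exp (2 * pi * \<i> * z))) (at z)"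
proof -
  have "((\<lambda>z. power_sum c (exp (2 * pi * \<i> * z))) has_field_derivative
     power_sum (\<lambda>m. real (Suc m) * c (Suc m)) (exp (2 * pi * \<i> * z)) * (2 * pi * \<i> * exp (2 * pi * \<i> * z))) (at z)"
    by (rule DERIV_chain2[OF power_sum_deriv[OF assms(1)]])
       (use norm_exp_2pi_i[OF assms(2)] in \<open>auto intro!: derivative_eq_intros\<close>)
  then show ?thesis
    using power_sum_times_index[OF assms(1) norm_exp_2pi_i[OF assms(2)]] by (simp add: mult_ac)
qed

text \<open>The coefficients of the series in \<open>x ^ k\<close> whose coefficients in \<open>x\<close> are \<open>c\<close>.\<close>

definition dilate :: "nat \<Rightarrow> (nat \<Rightarrow> real) \<Rightarrow> nat \<Rightarrow> real" where
  "dilate k c m = (if k dvd m then c (m div k) else 0)"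

lemma poly_growth_dilate:
  assumes "poly_growth c" shows "poly_growth (dilate k c)"
proof -
  obtain C l where c: "\<And>m. \<bar>c m\<bar> \<le> C * (real m + 1) ^ l"
    using assms by (auto simp: poly_growth_def)
  have C: "C \<ge> 0" using c[of 0] by auto
  show ?thesis
  proof (rule poly_growthI[of _ C l])
    fix m
    have "\<bar>c (m div k)\<bar> \<le> C * (real (m div k) + 1) ^ l" by (rule c)
    also have "\<dots> \<le> C * (real m + 1) ^ l"
      using C by (intro mult_left_mono power_mono) (auto intro: div_le_dividend)
    finally show "\<bar>dilate k c m\<bar> \<le> C * (real m + 1) ^ l" using C by (auto simp: dilate_def)
  qed
qed

lemma power_sum_dilate:
  assumes "k > 0"
  shows "power_sum (dilate k c) x = power_sum c (x ^ k)"
proof -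
  have "(\<Sum>m. of_real (dilate k c (k * m)) * x ^ (k * m)) = power_sum (dilate k c) x"
    unfolding power_sum_def
  proof (rule suminf_mono_reindex[of "\<lambda>m. k * m" "\<lambda>m. of_real (dilate k c m) * x ^ m"])
    show "strict_mono (\<lambda>m. k * m)" using assms by (simp add: strict_mono_def)
    fix n assume "n \<notin> range (\<lambda>m. k * m)"
    then have "\<not> k dvd n" by (auto simp: dvd_def)
    then show "of_real (dilate k c n) * x ^ n = 0" by (simp add: dilate_def)
  qed
  then show ?thesis using assms by (simp add: power_sum_def dilate_def power_mult)
qed

lemma index_power_times_dilate:
  "k > 0 \<Longrightarrow> real m ^ j * dilate k c m = real k ^ j * dilate k (\<lambda>m. real m ^ j * c m) m"
  by (auto simp: dilate_def power_mult_distrib)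

section \<open>The logarithm of the eta function as a Lambert series\<close>

text \<open>The divisor sum \<open>\<sigma>\<^sub>-\<^sub>1\<close>. At \<open>m = 0\<close> the sum ranges over an infinite set and is therefore \<open>0\<close>, which is
  the constant coefficient needed below.\<close>

definition sigma_inv :: "nat \<Rightarrow> real" where
  "sigma_inv m = (\<Sum>d | d dvd m. 1 / real d)"

lemma sigma_inv_nonneg: "sigma_inv m \<ge> 0"
  by (auto simp: sigma_inv_def intro: sum_nonneg)

lemma sigma_inv_le: "sigma_inv m \<le> real m"
proof (cases "m = 0")
  case False
  then have "{d. d dvd m} \<subseteq> {1..m}" by (auto dest: dvd_imp_le intro: Suc_leI dvd_pos_nat)
  have "sigma_inv m \<le> (\<Sum>d | d dvd m. 1)"
    unfolding sigma_inv_def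
  proof (rule sum_mono)
    fix d assume "d \<in> {d. d dvd m}"
    then have "d \<noteq> 0" using False by auto
    then show "1 / real d \<le> 1" by simp
  qed
  also have "\<dots> \<le> real (card {1..m})"
    using card_mono[OF _ \<open>{d. d dvd m} \<subseteq> {1..m}\<close>] by simp
  finally show ?thesis by simp
qed (simp add: sigma_inv_def)

lemma poly_growth_sigma_inv: "poly_growth sigma_inv"
proof (rule poly_growthI[of _ 1 1])
  fix m show "\<bar>sigma_inv m\<bar> \<le> 1 * (real m + 1) ^ 1"
    using sigma_inv_nonneg[of m] sigma_inv_le[of m] by simp
qed

text \<open>Expand each \<open>- Ln (1 - q ^ n) = (\<Sum>d. q ^ (n * d) / d)\<close> and collect the pairs \<open>(n, d)\<close> by their product
  \<open>m = n * d\<close>. The double series converges absolutely because \<open>Suc n * Suc d \<ge> n + d\<close> dominates it by a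
  product of two geometric series.\<close>

lemma Ln_product_series:
  fixes q :: complex
  assumes q: "norm q < 1"
  shows "(\<lambda>n. - Ln (1 - q ^ Suc n)) sums power_sum sigma_inv q"
proof -
  define f where "f = (\<lambda>(n, d). q ^ (Suc n * Suc d) / of_nat (Suc d))"
  have geom: "((\<lambda>n. norm q ^ n) has_sum (1 / (1 - norm q))) UNIV"
    using geometric_sums[of "norm q"] q by (intro sums_nonneg_imp_has_sum) auto
  have "(\<lambda>(n, d). norm q ^ n * norm q ^ d) summable_on UNIV \<times> UNIV"
    by (intro summable_on_SigmaI[where g = "\<lambda>n. norm q ^ n * (1 / (1 - norm q))"])
      (use has_sum_cmult_right[OF geom] summable_on_cmult_left[OF has_sum_imp_summable[OF geom], of "1 / (1 - norm q)"] in auto)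
  then have "(\<lambda>p. norm (f p)) summable_on UNIV \<times> UNIV"
  proof (rule Infinite_Sum.abs_summable_on_comparison_test')
    fix p :: "nat \<times> nat"
    obtain n d where p: "p = (n, d)" by force
    have "norm (f p) = norm q ^ (Suc n * Suc d) / real (Suc d)"
      by (simp add: f_def p norm_divide norm_power norm_mult del: of_nat_Suc power_Suc mult_Suc)
    also have "\<dots> \<le> norm q ^ (Suc n * Suc d)"
      by (simp add: field_simps)
    also have "\<dots> \<le> norm q ^ (n + d)"
      using q by (intro power_decreasing) auto
    finally show "norm (f p) \<le> (case p of (n, d) \<Rightarrow> norm q ^ n * norm q ^ d)"
      by (simp add: p power_add)
  qed
  then have sf: "f summable_on UNIV \<times> UNIV" by (rule abs_summable_summable)
  define S where "S = infsum f (UNIV \<times> UNIV)"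
  have S: "(f has_sum S) (UNIV \<times> UNIV)" using sf by (simp add: S_def)
  have row: "((\<lambda>d. f (n, d)) has_sum (- Ln (1 - q ^ Suc n))) UNIV" for n
  proof -
    define x where "x = q ^ Suc n"
    have x: "norm x < 1"
      using q power_less_one_iff[of "norm q" "Suc n"] by (simp add: x_def norm_power del: power_Suc)
    have "(\<lambda>d. - (- ((- (- x)) ^ d) / of_nat d)) sums - Ln (1 - x)"
      using sums_minus[OF Ln_series'[of "- x"]] x by simp
    then have "(\<lambda>d. x ^ d / of_nat d) sums - Ln (1 - x)" by simp
    then have "(\<lambda>d. x ^ Suc d / of_nat (Suc d)) sums - Ln (1 - x)"
      by (subst sums_Suc_iff) simp
    moreover have "summable (\<lambda>d. norm (x ^ Suc d / of_nat (Suc d)))"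
    proof (rule summable_comparison_test'[OF summable_geometric[of "norm x"]])
      fix d :: nat
      have "norm (x ^ Suc d / of_nat (Suc d)) = norm x ^ Suc d / real (Suc d)"
        by (simp add: norm_divide norm_power norm_mult del: of_nat_Suc)
      also have "\<dots> \<le> norm x ^ Suc d" by (simp add: field_simps)
      also have "\<dots> \<le> norm x ^ d" using x by (intro power_decreasing) auto
      finally show "norm (norm (x ^ Suc d / of_nat (Suc d))) \<le> norm x ^ d" by simp
    qed (use x in auto)
    ultimately have "((\<lambda>d. x ^ Suc d / of_nat (Suc d)) has_sum - Ln (1 - x)) UNIV"
      by (intro norm_summable_imp_has_sum)
    then show ?thesis by (simp add: f_def x_def power_mult[symmetric] del: power_Suc of_nat_Suc mult_Suc)
  qed
  have "((\<lambda>n. - Ln (1 - q ^ Suc n)) has_sum S) UNIV"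
    by (rule has_sum_SigmaD[OF S row])
  then have 1: "(\<lambda>n. - Ln (1 - q ^ Suc n)) sums S" by (rule has_sum_imp_sums)
  have "((\<lambda>(m, d). q ^ m / of_nat d) has_sum S) (SIGMA m:{1..}. {d. d dvd m})"
  proof (subst has_sum_reindex_bij_witness[where S = "SIGMA m:{1..}. {d. d dvd m}" and T = "UNIV \<times> UNIV"
      and j = "\<lambda>(m, d). (m div d - 1, d - 1)" and i = "\<lambda>(n, d). (Suc n * Suc d, Suc d)" and h = f and s' = S])
    fix a :: "nat \<times> nat" assume "a \<in> (SIGMA m:{1..}. {d. d dvd m})"
    then obtain m d where a: "a = (m, d)" "m > 0" "d dvd m" by auto
    then obtain k where k: "m = d * k" by auto
    have pos: "d > 0" "k > 0" using a k by auto
    have sk: "Suc (k - 1) = k" "Suc (d - 1) = d" using pos by auto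
    have div: "m div d = k" using k pos by simp
    show "(case case a of (m, d) \<Rightarrow> (m div d - 1, d - 1) of (n, d) \<Rightarrow> (Suc n * Suc d, Suc d)) = a"
      unfolding a(1) split div sk by (metis k mult.commute)
    show "f (case a of (m, d) \<Rightarrow> (m div d - 1, d - 1)) = (case a of (m, d) \<Rightarrow> q ^ m / complex_of_nat d)"
      by (simp only: a(1) split div sk f_def) (simp add: k mult.commute)
  qed (use S in \<open>auto simp del: mult_Suc mult_Suc_right\<close>)
  then have "((\<lambda>m. q ^ m * of_real (sigma_inv m)) has_sum S) {1..}"
  proof (rule has_sum_SigmaD)
    fix m :: nat assume m: "m \<in> {1..}"
    then have "finite {d. d dvd m}" by (intro finite_divisors_nat) auto
    then have "((\<lambda>d. q ^ m / of_nat d) has_sum (\<Sum>d | d dvd m. q ^ m / of_nat d)) {d. d dvd m}"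
      by (rule has_sum_finite)
    then show "((\<lambda>y. case (m, y) of (m, d) \<Rightarrow> q ^ m / of_nat d) has_sum q ^ m * of_real (sigma_inv m)) {d. d dvd m}"
      by (simp add: sigma_inv_def sum_distrib_left)
  qed
  then have "((\<lambda>m. of_real (sigma_inv m) * q ^ m) has_sum S) UNIV"
    by (rule has_sum_cong_neutral[THEN iffD1, rotated -1]) (auto simp: sigma_inv_def mult_ac not_less_eq_eq)
  then have "(\<lambda>m. of_real (sigma_inv m) * q ^ m) sums S" by (rule has_sum_imp_sums)
  then have "S = power_sum sigma_inv q" by (simp add: power_sum_def sums_iff)
  with 1 show ?thesis by simp
qed

lemma log_eta_eq:
  assumes "Im z > 0"
  shows "log_eta z = pi * \<i> * z / 12 - power_sum sigma_inv (exp (2 * pi * \<i> * z))"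
proof -
  define q where "q = exp (2 * pi * \<i> * z)"
  have qn: "exp (2 * pi * \<i> * of_nat (Suc n) * z) = q ^ Suc n" for n
    unfolding q_def exp_of_nat_mult[symmetric] by (simp add: algebra_simps)
  have "(\<lambda>n. Ln (1 - q ^ Suc n)) sums - power_sum sigma_inv q"
    using sums_minus[OF Ln_product_series[of q]] norm_exp_2pi_i[OF assms] by (simp add: q_def)
  then have "(\<Sum>n. Ln (1 - q ^ Suc n)) = - power_sum sigma_inv q" by (simp add: sums_iff)
  then show ?thesis unfolding log_eta_def qn by (simp add: q_def)
qed

lemma deriv_log_eta:
  assumes "Im z > 0"
  shows "deriv log_eta z = pi * \<i> / 12 - 2 * pi * \<i> * power_sum (\<lambda>m. real m * sigma_inv m) (exp (2 * pi * \<i> * z))"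
proof (rule DERIV_imp_deriv)
  have "((\<lambda>z. pi * \<i> * z / 12 - power_sum sigma_inv (exp (2 * pi * \<i> * z))) has_field_derivative
     pi * \<i> / 12 - 2 * pi * \<i> * power_sum (\<lambda>m. real m * sigma_inv m) (exp (2 * pi * \<i> * z))) (at z)"
    by (intro DERIV_diff power_sum_exp_deriv poly_growth_sigma_inv assms) (auto intro!: derivative_eq_intros)
  then show "(log_eta has_field_derivative
     pi * \<i> / 12 - 2 * pi * \<i> * power_sum (\<lambda>m. real m * sigma_inv m) (exp (2 * pi * \<i> * z))) (at z)"
    by (rule has_field_derivative_transform_within_open[of _ _ _ "{z. Im z > 0}"])
      (auto simp: assms log_eta_eq open_halfspace_Im_gt)
qed

lemma deriv2_log_eta:
  assumes "Im z > 0"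
  shows "deriv (deriv log_eta) z = (2 * pi)\<^sup>2 * power_sum (\<lambda>m. real m ^ 2 * sigma_inv m) (exp (2 * pi * \<i> * z))"
proof (rule DERIV_imp_deriv)
  have pg: "poly_growth (\<lambda>m. real m * sigma_inv m)"
    using poly_growth_power_times[OF poly_growth_sigma_inv, of 1] by simp
  have D: "((\<lambda>z. pi * \<i> / 12 - 2 * pi * \<i> * power_sum (\<lambda>m. real m * sigma_inv m) (exp (2 * pi * \<i> * z))) has_field_derivative
     0 - 2 * pi * \<i> * (2 * pi * \<i> * power_sum (\<lambda>m. real m * (real m * sigma_inv m)) (exp (2 * pi * \<i> * z)))) (at z)"
    by (intro DERIV_diff DERIV_cmult power_sum_exp_deriv pg assms) auto
  have eq: "0 - 2 * pi * \<i> * (2 * pi * \<i> * power_sum (\<lambda>m. real m * (real m * sigma_inv m)) (exp (2 * pi * \<i> * z)))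
    = (2 * pi)\<^sup>2 * power_sum (\<lambda>m. real m ^ 2 * sigma_inv m) (exp (2 * pi * \<i> * z))"
  proof -
    have "(\<lambda>m. real m * (real m * sigma_inv m)) = (\<lambda>m. real m ^ 2 * sigma_inv m)"
      by (simp add: power2_eq_square mult.assoc)
    moreover have "0 - 2 * pi * \<i> * (2 * pi * \<i> * w) = (2 * pi)\<^sup>2 * w" for w :: complex
    proof -
      have "0 - 2 * pi * \<i> * (2 * pi * \<i> * w) = - (\<i> * \<i>) * (of_real (2 * pi) * of_real (2 * pi)) * w"
        by (simp only: mult_ac diff_0 mult_minus_left mult_minus_right)
      then show ?thesis by (simp only: power2_eq_square i_squared of_real_mult) simp
    qed
    ultimately show ?thesis by (simp only:)
  qed
  from D[unfolded eq] show "(deriv log_eta has_field_derivative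
     (2 * pi)\<^sup>2 * power_sum (\<lambda>m. real m ^ 2 * sigma_inv m) (exp (2 * pi * \<i> * z))) (at z)"
    by (rule has_field_derivative_transform_within_open[of _ _ _ "{z. Im z > 0}"])
      (auto simp: assms deriv_log_eta open_halfspace_Im_gt)
qed

section \<open>The generating function of restricted overpartitions\<close>

text \<open>Overpartitions with all part sizes in \<open>B\<close>. For a general finite \<open>B\<close> one can add the part sizes one at
  a time, which builds the product \<open>\<Prod>n\<in>B. (1 + x ^ n) / (1 - x ^ n)\<close>.\<close>

definition restricted_overpartitions :: "nat set \<Rightarrow> nat \<Rightarrow> (nat multiset \<times> nat set) set" where
  "restricted_overpartitions B N = {(M, S). set_mset M \<subseteq> B \<and> sum_mset M = N \<and> S \<subseteq> set_mset M}"

lemma finite_restricted_overpartitions: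
  assumes "0 \<notin> B" shows "finite (restricted_overpartitions B N)"
  by (rule finite_subset[OF _ finite_overpartitions[of N]])
     (use assms in \<open>auto simp: restricted_overpartitions_def overpartitions_def\<close>)

text \<open>An overpartition that contains the new part \<open>n\<close> either contains it exactly once and overlined, or
  remains a valid overpartition when one copy of \<open>n\<close> is removed and the overlines are kept. The two cases
  are the sets \<open>once\<close> and \<open>more\<close>. This is the coefficient form of
  \<open>W' * (1 - x ^ n) = W * (1 + x ^ n)\<close>.\<close>

lemma card_restricted_overpartitions_insert:
  assumes "n \<notin> B" "n > 0" "0 \<notin> B"
  shows "card (restricted_overpartitions (insert n B) N) = card (restricted_overpartitions B N) +
     (if n \<le> N then card (restricted_overpartitions B (N - n))
        + card (restricted_overpartitions (insert n B) (N - n)) else 0)"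
proof (cases "n \<le> N")
  case False
  have "restricted_overpartitions (insert n B) N = restricted_overpartitions B N"
  proof -
    have "n \<notin># M" if "sum_mset M = N" for M
      using False that by (metis multi_member_split sum_mset.add_mset le_add1)
    then show ?thesis by (auto simp: restricted_overpartitions_def)
  qed
  then show ?thesis using False by simp
next
  case True
  let ?R = "restricted_overpartitions"
  define once where "once = (\<lambda>(M, S). (add_mset n M, insert n S)) ` ?R B (N - n)"
  define more where "more = (\<lambda>(M, S). (add_mset n M, S)) ` ?R (insert n B) (N - n)"
  have split: "?R (insert n B) N = ?R B N \<union> (once \<union> more)"
  proof (intro equalityI subsetI)
    fix p assume "p \<in> ?R (insert n B) N"
    then obtain M S where p: "p = (M, S)" "set_mset M \<subseteq> insert n B" "sum_mset M = N" "S \<subseteq> set_mset M"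
      by (auto simp: restricted_overpartitions_def)
    show "p \<in> ?R B N \<union> (once \<union> more)"
    proof (cases "n \<in># M")
      case False
      then show ?thesis using p by (auto simp: restricted_overpartitions_def)
    next
      case True
      then obtain M' where M': "M = add_mset n M'" by (meson multi_member_split)
      show ?thesis
      proof (cases "n \<in> S \<and> n \<notin># M'")
        case True
        then have "(M', S - {n}) \<in> ?R B (N - n)"
          using p M' by (auto simp: restricted_overpartitions_def)
        moreover have "p = (add_mset n M', insert n (S - {n}))" using True p M' by auto
        ultimately show ?thesis unfolding once_def by (force intro: image_eqI)
      next
        case False
        then have "(M', S) \<in> ?R (insert n B) (N - n)"
          using p M' by (auto simp: restricted_overpartitions_def)
        then show ?thesis unfolding more_def p M' by (force intro: image_eqI)
      qed
    qed
  next
    fix p assume "p \<in> ?R B N \<union> (once \<union> more)"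
    then show "p \<in> ?R (insert n B) N"
      using True by (auto simp: restricted_overpartitions_def once_def more_def)
  qed
  have fin: "finite (?R B K)" "finite (?R (insert n B) K)" for K
    using assms by (auto intro!: finite_restricted_overpartitions)
  have n_in: "n \<in># M" if "(M, S) \<in> once \<union> more" for M S
    using that by (auto simp: once_def more_def)
  have "n \<notin># M" if "(M, S) \<in> ?R B N" for M S
    using that assms by (auto simp: restricted_overpartitions_def)
  with n_in have "?R B N \<inter> (once \<union> more) = {}" by fast
  moreover have "n \<in> S \<and> n \<notin># M - {#n#}" if "(M, S) \<in> once" for M S
    using that assms by (auto simp: restricted_overpartitions_def once_def)
  moreover have "n \<in> S \<Longrightarrow> n \<in># M - {#n#}" if "(M, S) \<in> more" for M S
    using that by (auto simp: restricted_overpartitions_def more_def)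
  ultimately have "once \<inter> more = {}" "?R B N \<inter> (once \<union> more) = {}" by fast+
  moreover have "card once = card (?R B (N - n))"
    unfolding once_def
  proof (rule card_image)
    have notin: "n \<notin> S" if "(M, S) \<in> ?R B (N - n)" for M S
      using that assms by (auto simp: restricted_overpartitions_def)
    show "inj_on (\<lambda>(M, S). (add_mset n M, insert n S)) (?R B (N - n))"
    proof (rule inj_onI)
      fix p p' assume p: "p \<in> ?R B (N - n)" "p' \<in> ?R B (N - n)"
        and eq: "(case p of (M, S) \<Rightarrow> (add_mset n M, insert n S)) = (case p' of (M, S) \<Rightarrow> (add_mset n M, insert n S))"
      obtain M S M' S' where MS: "p = (M, S)" "p' = (M', S')" by (cases p, cases p')
      have "M = M'" "insert n S = insert n S'" using eq MS by simp_all
      moreover have "n \<notin> S" "n \<notin> S'" using p MS notin by auto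
      ultimately show "p = p'" using MS by (simp add: insert_ident)
    qed
  qed
  moreover have "card more = card (?R (insert n B) (N - n))"
    unfolding more_def by (rule card_image) (auto simp: inj_on_def)
  moreover have "finite once" "finite more"
    using fin by (auto simp: once_def more_def)
  ultimately show ?thesis
    using True fin by (simp add: split card_Un_disjoint)
qed

definition overpartition_fps :: "nat set \<Rightarrow> real fps" where
  "overpartition_fps B = Abs_fps (\<lambda>N. real (card (restricted_overpartitions B N)))"

lemma overpartition_fps_insert:
  assumes "n \<notin> B" "n > 0" "0 \<notin> B"
  shows "overpartition_fps (insert n B) * (1 - fps_X ^ n) = overpartition_fps B * (1 + fps_X ^ n)"
proof (rule fps_ext)
  fix N
  show "fps_nth (overpartition_fps (insert n B) * (1 - fps_X ^ n)) N =
        fps_nth (overpartition_fps B * (1 + fps_X ^ n)) N"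
    using card_restricted_overpartitions_insert[OF assms, of N]
    by (simp add: algebra_simps fps_X_power_mult_nth overpartition_fps_def)
qed

lemma overpartition_fps_empty: "overpartition_fps {} = 1"
proof (rule fps_ext)
  fix N
  have "restricted_overpartitions {} N = (if N = 0 then {({#}, {})} else {})"
    by (auto simp: restricted_overpartitions_def)
  then show "fps_nth (overpartition_fps {}) N = fps_nth 1 N"
    by (simp add: overpartition_fps_def)
qed

text \<open>The logarithmic derivative of \<open>(1 + x ^ n) / (1 - x ^ n)\<close>, namely
  \<open>2 * n * x ^ (n - 1) / (1 - x ^ (2 * n))\<close>.\<close>

definition part_log_deriv :: "nat \<Rightarrow> real fps" where
  "part_log_deriv n = Abs_fps (\<lambda>i. if n dvd Suc i \<and> odd (Suc i div n) then 2 * real n else 0)"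

lemma part_log_deriv_eq:
  assumes "n > 0"
  shows "part_log_deriv n * (1 - fps_X ^ (2 * n)) = fps_const (2 * real n) * fps_X ^ (n - 1)"
proof (rule fps_ext)
  fix i
  have "(n dvd Suc i \<and> odd (Suc i div n)) = (n dvd Suc (i - 2 * n) \<and> odd (Suc (i - 2 * n) div n))" if "2 * n \<le> i"
  proof -
    have e: "Suc i = Suc (i - 2 * n) + 2 * n" using that by simp
    have "n dvd Suc i \<longleftrightarrow> n dvd Suc (i - 2 * n)"
      by (subst e, subst dvd_add_left_iff) auto
    moreover have "Suc i div n = Suc (i - 2 * n) div n + 2"
      using assms by (subst e, subst div_mult_self1) auto
    ultimately show ?thesis by simp
  qed
  moreover have "(n dvd Suc i \<and> odd (Suc i div n)) = (i = n - 1)" if "\<not> 2 * n \<le> i"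
  proof
    assume *: "n dvd Suc i \<and> odd (Suc i div n)"
    then obtain k where k: "Suc i = n * k" by auto
    have "odd k" using * k assms by simp
    moreover have "k \<le> 2" using k that assms by (metis Suc_leI linorder_not_le mult.commute mult_le_cancel1)
    ultimately have "k = 1" by (cases k) (auto simp: le_Suc_eq)
    then show "i = n - 1" using k by simp
  qed (use assms in auto)
  ultimately show "fps_nth (part_log_deriv n * (1 - fps_X ^ (2 * n))) i =
     fps_nth (fps_const (2 * real n) * fps_X ^ (n - 1)) i"
    using assms by (auto simp: algebra_simps fps_X_power_mult_right_nth fps_X_power_mult_nth part_log_deriv_def fps_X_power_nth)
qed

text \<open>The logarithmic derivative of a product is the sum of the logarithmic derivatives of its factors.
  Working with it keeps everything inside formal power series, with no infinite product to be
  rearranged.\<close>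

lemma overpartition_fps_deriv:
  assumes "finite B" "0 \<notin> B"
  shows "fps_deriv (overpartition_fps B) = (\<Sum>n\<in>B. part_log_deriv n) * overpartition_fps B"
  using assms
proof (induction B rule: finite_induct)
  case empty
  then show ?case by (simp add: overpartition_fps_empty)
next
  case (insert n B)
  then have n: "n > 0" and B: "0 \<notin> B" by auto
  define V W L where "V = overpartition_fps (insert n B)" and "W = overpartition_fps B" and "L = (\<Sum>n\<in>B. part_log_deriv n)"
  define X where "X = (fps_X :: real fps) ^ n"
  define D where "D = fps_const (real n) * fps_X ^ (n - 1)"
  have X: "fps_deriv X = D" unfolding X_def D_def by (simp add: fps_deriv_power)
  have VW: "V * (1 - X) = W * (1 + X)"
    unfolding V_def W_def X_def using overpartition_fps_insert insert.hyps n B by blast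
  have W': "fps_deriv W = L * W" using insert.IH B by (simp add: W_def L_def)
  have l: "part_log_deriv n * (1 - X * X) = 2 * D"
  proof -
    have "X * X = fps_X ^ (2 * n)" by (simp only: X_def mult_2 power_add)
    moreover have "fps_const (2 * real n) = 2 * fps_const (real n)"
      by (simp only: mult_2 flip: fps_const_add)
    ultimately show ?thesis
      using part_log_deriv_eq[OF n] by (simp only: D_def mult.assoc)
  qed
  have "fps_deriv V * (1 - X) - V * D = L * W * (1 + X) + W * D"
    using arg_cong[OF VW, of fps_deriv] by (simp add: X W' algebra_simps)
  then have V': "fps_deriv V * (1 - X) = V * D + L * (W * (1 + X)) + W * D"
    by (simp add: algebra_simps)
  \<comment> \<open>multiply by \<open>1 + X\<close> to eliminate \<open>W\<close> in favour of \<open>V\<close>, and cancel \<open>1 - X * X\<close> at the end\<close>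
  have "fps_deriv V * (1 - X * X) = fps_deriv V * (1 - X) * (1 + X)" by (simp add: algebra_simps)
  also have "\<dots> = V * D * (1 + X) + L * (V * (1 - X)) * (1 + X) + (W * (1 + X)) * D"
    unfolding V' VW by (simp add: algebra_simps)
  also have "\<dots> = V * (2 * D) + L * V * (1 - X * X)"
    unfolding VW[symmetric] by (simp add: algebra_simps)
  also have "\<dots> = (part_log_deriv n + L) * V * (1 - X * X)"
    unfolding l[symmetric] by (simp add: algebra_simps)
  finally have "fps_deriv V * (1 - X * X) = (part_log_deriv n + L) * V * (1 - X * X)" .
  moreover have "fps_nth (1 - X * X) 0 = 1" using n by (simp add: X_def)
  then have "1 - X * X \<noteq> 0" by (metis fps_zero_nth zero_neq_one)
  ultimately have "fps_deriv V = (part_log_deriv n + L) * V" by simp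
  then show ?case using insert.hyps by (simp add: V_def L_def)
qed

definition allowed :: "nat \<Rightarrow> nat \<Rightarrow> nat \<Rightarrow> bool" where
  "allowed s t n \<longleftrightarrow> \<not> s dvd n \<and> \<not> t dvd n"

text \<open>The coefficients of the logarithm of the generating function: expanding
  \<open>ln ((1 + x ^ n) / (1 - x ^ n)) = (\<Sum>d odd. (2 / d) * x ^ (n * d))\<close> and summing over the allowed \<open>n\<close>, the
  coefficient of \<open>x ^ m\<close> collects the odd \<open>d\<close> with \<open>m = n * d\<close>.\<close>

definition log_coeff :: "nat \<Rightarrow> nat \<Rightarrow> nat \<Rightarrow> real" where
  "log_coeff s t m = (\<Sum>d | d dvd m \<and> odd d \<and> allowed s t (m div d). 2 / real d)"

lemma index_times_log_coeff:
  assumes "m > 0"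
  shows "real m * log_coeff s t m = (\<Sum>n | n dvd m \<and> odd (m div n) \<and> allowed s t n. 2 * real n)"
proof -
  have inv: "m div (m div d) = d \<and> m div d dvd m" if "d dvd m" for d
    using that assms by (elim dvdE) simp
  show ?thesis
    unfolding log_coeff_def sum_distrib_left
  proof (rule sum.reindex_bij_witness[where i = "\<lambda>n. m div n" and j = "\<lambda>d. m div d"])
    fix d assume "d \<in> {d. d dvd m \<and> odd d \<and> allowed s t (m div d)}"
    then show "2 * real (m div d) = real m * (2 / real d)"
      by (auto simp: real_of_nat_div)
  qed (use inv in auto)
qed

text \<open>Up to degree \<open>Suc N\<close> only the finitely many allowed part sizes \<open>\<le> Suc N\<close> matter, so the recurrence can
  be read off from the logarithmic derivative of a finite product.\<close>

lemma pbar_recurrence: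
  "real (Suc N) * real (pbar s t (Suc N)) =
    (\<Sum>i\<le>N. real (Suc i) * log_coeff s t (Suc i) * real (pbar s t (N - i)))"
proof -
  define B where "B = {n\<in>{1..Suc N}. allowed s t n}"
  have B: "finite B" "0 \<notin> B" by (auto simp: B_def)
  have pb: "fps_nth (overpartition_fps B) j = real (pbar s t j)" if "j \<le> Suc N" for j
  proof -
    have "m \<le> j" if "m \<in># M" "sum_mset M = j" for m M
      using that by (metis multi_member_split sum_mset.add_mset le_add1)
    then have "restricted_overpartitions B j = {(M, S) \<in> overpartitions j. \<forall>m\<in>#M. \<not> s dvd m \<and> \<not> t dvd m}"
      using that by (fastforce simp: restricted_overpartitions_def overpartitions_def B_def allowed_def
          intro: Suc_leI gr0I)
    then show ?thesis by (simp add: overpartition_fps_def pbar_def)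
  qed
  have lc: "fps_nth (\<Sum>n\<in>B. part_log_deriv n) i = real (Suc i) * log_coeff s t (Suc i)" if "i \<le> N" for i
  proof -
    have "fps_nth (\<Sum>n\<in>B. part_log_deriv n) i = (\<Sum>n\<in>B. if n dvd Suc i \<and> odd (Suc i div n) then 2 * real n else 0)"
      by (simp add: fps_sum_nth part_log_deriv_def)
    also have "\<dots> = (\<Sum>n\<in>B \<inter> {n. n dvd Suc i \<and> odd (Suc i div n)}. 2 * real n)"
      using B by (simp add: sum.inter_restrict)
    also have "B \<inter> {n. n dvd Suc i \<and> odd (Suc i div n)} = {n. n dvd Suc i \<and> odd (Suc i div n) \<and> allowed s t n}"
      using that by (auto simp: B_def Suc_le_eq allowed_def dest: dvd_imp_le intro: gr0I)
    finally show ?thesis using index_times_log_coeff[of "Suc i" s t] by simp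
  qed
  have "real (Suc N) * real (pbar s t (Suc N)) = fps_nth (fps_deriv (overpartition_fps B)) N"
    using pb[of "Suc N"] by simp
  also have "\<dots> = (\<Sum>i\<le>N. fps_nth (\<Sum>n\<in>B. part_log_deriv n) i * fps_nth (overpartition_fps B) (N - i))"
    unfolding overpartition_fps_deriv[OF B] fps_mult_nth by (simp add: atLeast0AtMost)
  also have "\<dots> = (\<Sum>i\<le>N. real (Suc i) * log_coeff s t (Suc i) * real (pbar s t (N - i)))"
    by (intro sum.cong) (simp_all add: lc pb)
  finally show ?thesis .
qed

lemma log_coeff_nonneg: "log_coeff s t m \<ge> 0"
  by (auto simp: log_coeff_def intro: sum_nonneg)

lemma log_coeff_0: "log_coeff s t 0 = 0"
  by (simp add: log_coeff_def allowed_def)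

lemma log_coeff_le: "log_coeff s t m \<le> 2 * sigma_inv m"
proof (cases "m = 0")
  case False
  then have "log_coeff s t m \<le> (\<Sum>d | d dvd m. 2 / real d)"
    unfolding log_coeff_def by (intro sum_mono2) auto
  then show ?thesis by (simp add: sigma_inv_def sum_distrib_left)
qed (simp add: log_coeff_0 sigma_inv_nonneg)

text \<open>The divisor \<open>d = 1\<close> alone contributes \<open>2\<close>.\<close>

lemma log_coeff_ge:
  assumes "allowed s t m" shows "log_coeff s t m \<ge> 2"
proof -
  have m: "m > 0" using assms by (auto simp: allowed_def intro: gr0I)
  have "finite {d. d dvd m \<and> odd d \<and> allowed s t (m div d)}"
    using m by (intro finite_subset[OF _ finite_divisors_nat[of m]]) auto
  then have "(\<Sum>d\<in>{1}. 2 / real d) \<le> log_coeff s t m"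
    unfolding log_coeff_def using assms by (intro sum_mono2) auto
  then show ?thesis by simp
qed

lemma poly_growth_log_coeff: "poly_growth (log_coeff s t)"
proof (rule poly_growthI[of _ 2 1])
  fix m show "\<bar>log_coeff s t m\<bar> \<le> 2 * (real m + 1) ^ 1"
    using log_coeff_nonneg[of s t m] log_coeff_le[of s t m] sigma_inv_le[of m] by simp
qed

text \<open>The Taylor coefficients of \<open>exp (power_sum (log_coeff s t) x)\<close> satisfy the same recurrence and initial
  value as \<open>pbar\<close>. Holomorphy in the unit disc then gives the convergence of the series there,
  without any a priori bound on \<open>pbar\<close>.\<close>

lemma pbar_generating_function:
  fixes x :: complex
  assumes "norm x < 1"
  shows "(\<lambda>N. of_nat (pbar s t N) * x ^ N) sums exp (power_sum (log_coeff s t) x)"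
proof -
  define a where "a = log_coeff s t"
  define g where "g = (power_sum a :: complex \<Rightarrow> complex)"
  define \<Phi> where "\<Phi> = (\<lambda>x. exp (g x))"
  have pg: "poly_growth a" by (simp add: a_def poly_growth_log_coeff)
  have g': "(g has_field_derivative deriv g x) (at x)" if "norm x < 1" for x
    unfolding g_def using power_sum_deriv[OF pg that] DERIV_imp_deriv by metis
  have \<Phi>': "(\<Phi> has_field_derivative deriv g x * \<Phi> x) (at x)" if "norm x < 1" for x
    unfolding \<Phi>_def using g'[OF that] by (auto intro!: derivative_eq_intros)
  have holo_ball: "\<Phi> holomorphic_on ball 0 1"
    unfolding holomorphic_on_open[OF open_ball] using \<Phi>' by (metis dist_0_norm mem_ball)
  then have holo: "\<Phi> holomorphic_on eball 0 1"
    by (rule holomorphic_on_subset) auto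
  define F where "F = fps_expansion \<Phi> 0"
  define G where "G = Abs_fps (\<lambda>m. complex_of_real (a m))"
  have ball: "eventually (\<lambda>x :: complex. norm x < 1) (nhds 0)"
    using eventually_nhds_in_open[of "ball 0 1" "0::complex"] by simp
  have F: "\<Phi> has_fps_expansion F"
    unfolding F_def by (rule has_fps_expansion_fps_expansion[OF _ _ holo_ball]) auto
  have G: "g has_fps_expansion G"
  proof (rule has_fps_expansionI)
    show "\<forall>\<^sub>F u in nhds 0. (\<lambda>n. fps_nth G n * u ^ n) sums g u"
      using ball by eventually_elim
        (use summable_power_sum'[OF pg] in \<open>auto simp: G_def g_def power_sum_def summable_sums\<close>)
  qed
  have prod: "(\<lambda>x. deriv g x * \<Phi> x) has_fps_expansion fps_deriv G * F"
    by (intro has_fps_expansion_mult has_fps_expansion_deriv F G)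
  have "\<forall>\<^sub>F x in nhds 0. deriv g x * \<Phi> x = deriv \<Phi> x"
    using ball by eventually_elim (rule DERIV_imp_deriv[OF \<Phi>', symmetric])
  then have "deriv \<Phi> has_fps_expansion fps_deriv G * F"
    using prod by (rule has_fps_expansion_cong[THEN iffD1, OF _ refl])
  then have FG: "fps_deriv F = fps_deriv G * F"
    by (rule fps_expansion_unique_complex[OF has_fps_expansion_deriv[OF F]])
  have coeff: "fps_nth F N = of_nat (pbar s t N)" for N
  proof (induction N rule: less_induct)
    case (less N)
    show ?case
    proof (cases N)
      case 0
      have "g 0 = 0"
        by (simp add: g_def power_sum_def a_def log_coeff_0 powser_zero)
      then show ?thesis
        using has_fps_expansion_imp_0_eq_fps_nth_0[OF F] by (simp add: 0 pbar_0 \<Phi>_def)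
    next
      case (Suc K)
      have "of_nat (Suc K) * fps_nth F (Suc K) = fps_nth (fps_deriv F) K" by simp
      also have "\<dots> = (\<Sum>i\<le>K. of_nat (Suc i) * of_real (a (Suc i)) * fps_nth F (K - i))"
        unfolding FG fps_mult_nth by (simp add: G_def atLeast0AtMost)
      also have "\<dots> = of_real (\<Sum>i\<le>K. real (Suc i) * a (Suc i) * real (pbar s t (K - i)))"
        unfolding of_real_sum by (intro sum.cong) (simp_all add: less Suc)
      also have "\<dots> = of_nat (Suc K) * of_nat (pbar s t (Suc K))"
        unfolding a_def pbar_recurrence[symmetric] by simp
      finally show ?thesis using Suc by (simp del: of_nat_Suc)
    qed
  qed
  have "ereal (norm x) < 1" using assms by simp
  then have "ereal (norm x) < fps_conv_radius F"
    unfolding F_def by (rule less_le_trans[OF _ conv_radius_fps_expansion[OF holo]])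
  then have "(\<lambda>N. fps_nth F N * x ^ N) sums eval_fps F x"
    unfolding eval_fps_def by (intro summable_sums summable_fps)
  moreover have "eval_fps F x = \<Phi> x"
    using eval_fps_expansion'[OF holo] assms by (simp add: F_def)
  ultimately show ?thesis by (simp add: coeff \<Phi>_def g_def a_def)
qed

section \<open>The auxiliary functions on the imaginary axis\<close>

text \<open>The right-hand side lists the coefficients of \<open>log H\<close>, one dilation for each eta function in \<open>H\<close>. Two
  inclusion-exclusions are at work: \<open>2 * dilate k sigma_inv - dilate (2 * k) sigma_inv\<close> discards the even
  divisors \<open>d\<close>, and the four values \<open>k = 1, s, t, s * t\<close> discard the parts divisible by \<open>s\<close> or \<open>t\<close>.
  Coprimality enters because an integer divisible by both must be divisible by \<open>s * t\<close>.\<close>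

lemma log_coeff_eq:
  assumes "coprime s t" "s > 0" "t > 0"
  shows "log_coeff s t m = 2 * sigma_inv m + 2 * dilate (s * t) sigma_inv m
      + dilate (2 * s) sigma_inv m + dilate (2 * t) sigma_inv m
      - dilate 2 sigma_inv m - dilate (2 * (s * t)) sigma_inv m
      - 2 * dilate s sigma_inv m - 2 * dilate t sigma_inv m"
proof (cases "m = 0")
  case True
  then show ?thesis by (simp add: log_coeff_0 dilate_def sigma_inv_def)
next
  case False
  then have m: "m > 0" by simp
  define D where "D = {d. d dvd m \<and> odd d}"
  have fin: "finite {d. d dvd m}" "finite D" using m by (auto simp: D_def intro: finite_subset[OF _ finite_divisors_nat[of m]])
  have scaled: "dilate k sigma_inv m = (\<Sum>d | d dvd m \<and> k dvd m div d. 1 / real d)" if k: "k > 0" for k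
  proof (cases "k dvd m")
    case True
    then obtain l where l: "m = k * l" by auto
    have "l > 0" using l m by auto
    have "d dvd k * l \<and> k dvd k * l div d \<longleftrightarrow> d dvd l" for d
    proof
      assume *: "d dvd k * l \<and> k dvd k * l div d"
      then obtain c where c: "k * l = d * c" by auto
      have "d > 0" using c k \<open>l > 0\<close> by (intro gr0I) auto
      with * c obtain c' where "c = k * c'" by auto
      then have "k * l = k * (d * c')" using c by (metis mult.left_commute)
      then show "d dvd l" using k by simp
    next
      assume "d dvd l"
      then obtain c where "l = d * c" by auto
      then show "d dvd k * l \<and> k dvd k * l div d" using \<open>l > 0\<close> by simp
    qed
    then have "{d. d dvd m \<and> k dvd m div d} = {d. d dvd l}"
      unfolding l by blast
    then show ?thesis using True k by (simp add: dilate_def sigma_inv_def l)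
  next
    case False
    then have "{d. d dvd m \<and> k dvd m div d} = {}"
      by (metis (no_types, lifting) Collect_empty_eq dvd_mult dvd_mult_div_cancel)
    then show ?thesis using False by (simp only: dilate_def if_False sum.empty)
  qed
  \<comment> \<open>the even divisors with cofactor divisible by \<open>k\<close> correspond to all divisors with cofactor divisible by \<open>2 * k\<close>\<close>
  have halve: "2 * dilate k sigma_inv m - dilate (2 * k) sigma_inv m
      = (\<Sum>d\<in>D. if k dvd m div d then 2 / real d else 0)" if k: "k > 0" for k
  proof -
    have "dilate (2 * k) sigma_inv m = (\<Sum>d | d dvd m \<and> 2 * k dvd m div d. 1 / real d)"
      using k by (intro scaled) auto
    also have "\<dots> = (\<Sum>d | d dvd m \<and> even d \<and> k dvd m div d. 2 / real d)"
    proof (rule sum.reindex_bij_witness[where i = "\<lambda>d. d div 2" and j = "\<lambda>d. 2 * d"])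
      fix d assume "d \<in> {d. d dvd m \<and> 2 * k dvd m div d}"
      then obtain c where c: "m = d * (2 * k * c)" using m by (auto elim!: dvdE)
      have "d > 0" using c m by auto
      then have "m div (2 * d) = k * c" unfolding c by (simp add: mult_ac)
      then show "2 * d \<in> {d. d dvd m \<and> even d \<and> k dvd m div d}" by (auto simp: c)
    next
      fix d assume "d \<in> {d. d dvd m \<and> even d \<and> k dvd m div d}"
      then obtain e where e: "d = 2 * e" "2 * e dvd m" "k dvd m div (2 * e)" by auto
      then obtain c where c: "m = 2 * e * c" by auto
      have "e > 0" using c m by auto
      then have "k dvd c" using e unfolding c by simp
      then show "d div 2 \<in> {d. d dvd m \<and> 2 * k dvd m div d}" using \<open>e > 0\<close> by (auto simp: e c)
    qed auto
    finally have even: "dilate (2 * k) sigma_inv m = (\<Sum>d | d dvd m \<and> even d \<and> k dvd m div d. 2 / real d)" .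
    have "2 * dilate k sigma_inv m = (\<Sum>d | d dvd m \<and> k dvd m div d. 2 / real d)"
      by (simp add: scaled k sum_distrib_left)
    also have "{d. d dvd m \<and> k dvd m div d} = {d. d dvd m \<and> even d \<and> k dvd m div d} \<union> {d \<in> D. k dvd m div d}"
      by (auto simp: D_def)
    also have "(\<Sum>d\<in>\<dots>. 2 / real d) = dilate (2 * k) sigma_inv m + (\<Sum>d\<in>{d \<in> D. k dvd m div d}. 2 / real d)"
      unfolding even using fin by (intro sum.union_disjoint) (auto simp: D_def intro: finite_subset[OF _ fin(1)])
    finally show ?thesis using fin by (simp add: sum.inter_filter)
  qed
  have one: "sigma_inv m = dilate 1 sigma_inv m" by (simp add: dilate_def)
  have "log_coeff s t m = (\<Sum>d\<in>{d\<in>D. allowed s t (m div d)}. 2 / real d)"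
    unfolding log_coeff_def D_def by (intro sum.cong) auto
  also have "\<dots> = (\<Sum>d\<in>D. if allowed s t (m div d) then 2 / real d else 0)"
    using fin by (simp add: sum.inter_filter)
  also have "\<dots> = (\<Sum>d\<in>D. (if 1 dvd m div d then 2 / real d else 0) - (if s dvd m div d then 2 / real d else 0)
       - (if t dvd m div d then 2 / real d else 0) + (if s * t dvd m div d then 2 / real d else 0))"
    using assms by (intro sum.cong) (auto simp: allowed_def dest: dvd_mult_left dvd_mult_right intro: divides_mult)
  also have "\<dots> = (2 * dilate 1 sigma_inv m - dilate (2 * 1) sigma_inv m)
     - (2 * dilate s sigma_inv m - dilate (2 * s) sigma_inv m)
     - (2 * dilate t sigma_inv m - dilate (2 * t) sigma_inv m)
     + (2 * dilate (s * t) sigma_inv m - dilate (2 * (s * t)) sigma_inv m)"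
    using assms by (simp only: halve nat_0_less_mult_iff zero_less_one sum.distrib sum_subtractf simp_thms)
  finally show ?thesis using one by simp
qed

text \<open>With \<open>g y = ln (H (\<i> y))\<close>, the \<open>j\<close>-th moment is \<open>(- 1) ^ j * g\<^bsup>(j)\<^esup>(y) / (2 \<pi>) ^ j\<close>.\<close>

definition moment :: "nat \<Rightarrow> nat \<Rightarrow> nat \<Rightarrow> real \<Rightarrow> real" where
  "moment j s t y = power_sum (\<lambda>m. real m ^ j * log_coeff s t m) (exp (- 2 * pi * y))"

definition sigma_moment :: "nat \<Rightarrow> real \<Rightarrow> real" where
  "sigma_moment j x = power_sum (\<lambda>m. real m ^ j * sigma_inv m) x"

lemma moment_sums:
  assumes "y > 0"
  shows "(\<lambda>m. real m ^ j * log_coeff s t m * exp (- 2 * pi * y) ^ m) sums moment j s t y"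
  unfolding moment_def power_sum_def
  using summable_power_sum'[OF poly_growth_power_times[OF poly_growth_log_coeff], of "exp (- 2 * pi * y)" j s t] assms
  by (auto intro: summable_sums)

lemma sigma_moment_dilate_sums:
  assumes "k > 0" "0 \<le> x" "x < 1"
  shows "(\<lambda>m. real m ^ j * dilate k sigma_inv m * x ^ m) sums (real k ^ j * sigma_moment j (x ^ k))"
proof -
  have "(\<lambda>m. of_real (dilate k (\<lambda>m. real m ^ j * sigma_inv m) m) * x ^ m) sums
     power_sum (dilate k (\<lambda>m. real m ^ j * sigma_inv m)) x"
    unfolding power_sum_def using assms
    by (intro summable_sums summable_power_sum' poly_growth_dilate poly_growth_power_times poly_growth_sigma_inv) auto
  from sums_mult[OF this, of "real k ^ j"] show ?thesis
    using assms by (simp add: index_power_times_dilate power_sum_dilate sigma_moment_def mult.assoc)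
qed

text \<open>Differentiating \<open>j\<close> times, each dilation by \<open>k\<close> picks up a factor \<open>k ^ j\<close>; these factors are what the
  weights in the definition of \<open>b\<close> reproduce.\<close>

lemma moment_eq:
  assumes "coprime s t" "s > 0" "t > 0" "y > 0"
  defines "x \<equiv> exp (- 2 * pi * y)"
  shows "moment j s t y = 2 * sigma_moment j x + 2 * (real (s * t) ^ j * sigma_moment j (x ^ (s * t)))
    + real (2 * s) ^ j * sigma_moment j (x ^ (2 * s)) + real (2 * t) ^ j * sigma_moment j (x ^ (2 * t))
    - 2 ^ j * sigma_moment j (x ^ 2) - real (2 * (s * t)) ^ j * sigma_moment j (x ^ (2 * (s * t)))
    - 2 * (real s ^ j * sigma_moment j (x ^ s)) - 2 * (real t ^ j * sigma_moment j (x ^ t))"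
proof -
  have x: "0 \<le> x" "x < 1" using assms by (auto simp: x_def)
  define D where "D = (\<lambda>k m. real m ^ j * dilate k sigma_inv m * x ^ m)"
  have D: "D k sums (real k ^ j * sigma_moment j (x ^ k))" if "k > 0" for k
    unfolding D_def using sigma_moment_dilate_sums[OF that x] .
  have "(\<lambda>m. 2 * D 1 m + 2 * D (s * t) m + D (2 * s) m + D (2 * t) m - D 2 m - D (2 * (s * t)) m
      - 2 * D s m - 2 * D t m) sums
     (2 * (real 1 ^ j * sigma_moment j (x ^ 1)) + 2 * (real (s * t) ^ j * sigma_moment j (x ^ (s * t)))
    + real (2 * s) ^ j * sigma_moment j (x ^ (2 * s)) + real (2 * t) ^ j * sigma_moment j (x ^ (2 * t))
    - real 2 ^ j * sigma_moment j (x ^ 2) - real (2 * (s * t)) ^ j * sigma_moment j (x ^ (2 * (s * t)))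
    - 2 * (real s ^ j * sigma_moment j (x ^ s)) - 2 * (real t ^ j * sigma_moment j (x ^ t)))"
    using assms by (intro sums_add sums_diff sums_mult D) auto
  moreover have "(\<lambda>m. 2 * D 1 m + 2 * D (s * t) m + D (2 * s) m + D (2 * t) m - D 2 m - D (2 * (s * t)) m
      - 2 * D s m - 2 * D t m) = (\<lambda>m. real m ^ j * log_coeff s t m * x ^ m)"
  proof
    fix m
    have one: "dilate 1 sigma_inv m = sigma_inv m" by (simp add: dilate_def)
    show "2 * D 1 m + 2 * D (s * t) m + D (2 * s) m + D (2 * t) m - D 2 m - D (2 * (s * t)) m
      - 2 * D s m - 2 * D t m = real m ^ j * log_coeff s t m * x ^ m"
      unfolding D_def one log_coeff_eq[OF assms(1-3)] by (simp add: algebra_simps)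
  qed
  moreover have "(\<lambda>m. real m ^ j * log_coeff s t m * x ^ m) sums moment j s t y"
    unfolding x_def by (rule moment_sums) fact
  ultimately show ?thesis by (auto dest: sums_unique2)
qed

lemma exp_imaginary_axis:
  fixes y :: real
  shows "exp (2 * pi * \<i> * (of_nat k * (\<i> * y))) = of_real (exp (- 2 * pi * y) ^ k)"
proof -
  have "2 * pi * \<i> * (of_nat k * (\<i> * y)) = of_nat k * of_real (- 2 * pi * y)"
    by (simp add: algebra_simps)
  then show ?thesis by (simp only: exp_of_nat_mult exp_of_real of_real_power)
qed

lemma sigma_moment_complex:
  assumes "k > 0" "y > 0"
  shows "power_sum (\<lambda>m. real m ^ j * sigma_inv m) (complex_of_real (exp (- 2 * pi * y) ^ k))
     = of_real (sigma_moment j (exp (- 2 * pi * y) ^ k))"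
proof -
  have "exp (- 2 * pi * y) ^ k < 1"
    using assms by (subst power_less_one_iff) auto
  then show ?thesis
    unfolding sigma_moment_def
    by (intro power_sum_of_real poly_growth_power_times poly_growth_sigma_inv) auto
qed

lemma mu_1_imaginary_axis:
  assumes "k > 0" "y > 0"
  shows "mu 1 (of_nat k * (\<i> * of_real y)) =
    of_real ((real k)\<^sup>2 * y\<^sup>2 * (1 / 24 - sigma_moment 1 (exp (- 2 * pi * y) ^ k)))"
proof -
  define P where "P = sigma_moment 1 (exp (- 2 * pi * y) ^ k)"
  have "power_sum (\<lambda>m. real m * sigma_inv m) (complex_of_real (exp (- 2 * pi * y) ^ k)) = of_real P"
    using sigma_moment_complex[OF assms, of 1] by (simp only: power_one_right P_def)
  then have "deriv log_eta (of_nat k * (\<i> * of_real y)) = pi * \<i> / 12 - 2 * pi * \<i> * of_real P"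
    using assms by (subst deriv_log_eta) (simp_all only: exp_imaginary_axis, simp)
  then have "mu 1 (of_nat k * (\<i> * of_real y)) =
      - ((of_nat k * (\<i> * of_real y)) ^ 2 / (2 * pi * \<i>)) * (pi * \<i> / 12 - 2 * pi * \<i> * of_real P)"
    by (simp only: mu_def numeral_2_eq_2 funpow.simps o_apply id_apply add_Suc_right add_0_right One_nat_def)
  also have "pi * \<i> / 12 - 2 * pi * \<i> * of_real P = (2 * pi * \<i>) * of_real (1 / 24 - P)"
    by (simp add: algebra_simps)
  also have "- ((of_nat k * (\<i> * of_real y)) ^ 2 / (2 * pi * \<i>)) * ((2 * pi * \<i>) * of_real (1 / 24 - P))
      = - ((of_nat k * (\<i> * of_real y)) ^ 2 * of_real (1 / 24 - P))"
  proof -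
    have cancel: "- (Z / c) * (c * w) = - (Z * w)" if "c \<noteq> 0" for c Z w :: complex
      using that by simp
    show ?thesis by (rule cancel) simp
  qed
  also have "(of_nat k * (\<i> * of_real y)) ^ 2 = - of_real ((real k)\<^sup>2 * y\<^sup>2)"
    by (simp add: power_mult_distrib)
  finally show ?thesis
    unfolding P_def[symmetric] by simp
qed

lemma mu_2_imaginary_axis:
  assumes "k > 0" "y > 0"
  shows "mu 2 (of_nat k * (\<i> * of_real y)) =
    of_real (2 * pi * (real k) ^ 3 * y ^ 3 * sigma_moment 2 (exp (- 2 * pi * y) ^ k))"
proof -
  define P where "P = sigma_moment 2 (exp (- 2 * pi * y) ^ k)"
  have "deriv (deriv log_eta) (of_nat k * (\<i> * of_real y)) = complex_of_real ((2 * pi)\<^sup>2) * complex_of_real P"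
    using assms by (subst deriv2_log_eta)
      (simp_all only: exp_imaginary_axis sigma_moment_complex[OF assms] P_def, simp)
  then have "mu 2 (of_nat k * (\<i> * of_real y)) =
      - ((of_nat k * (\<i> * of_real y)) ^ 3 / (2 * pi * \<i>)) * (complex_of_real ((2 * pi)\<^sup>2) * complex_of_real P)"
    by (simp only: mu_def numeral_2_eq_2 numeral_3_eq_3 funpow.simps o_apply id_apply add_Suc_right add_0_right One_nat_def)
  then show ?thesis
    unfolding P_def[symmetric]
    by (simp add: power_mult_distrib power3_eq_cube power2_eq_square)
qed

text \<open>The contributions \<open>1 / 24\<close> of the factors \<open>exp (\<pi> \<i> z / 12)\<close> of eta cancel, since the weighted sum of
  the squares of the eight dilation factors vanishes.\<close>

lemma b_1_eq:
  assumes "coprime s t" "s > 0" "t > 0" "y > 0"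
  shows "b 1 s t y = of_real (- 2 * real s * real t * y\<^sup>2 * moment 1 s t y)"
proof -
  define x where "x = exp (- 2 * pi * y)"
  have mu: "mu 1 (of_nat k * (\<i> * of_real y)) = of_real ((real k)\<^sup>2 * y\<^sup>2 * (1 / 24 - sigma_moment 1 (x ^ k)))"
    if "k > 0" for k using mu_1_imaginary_axis[OF that assms(4)] by (simp only: x_def)
  have "b 1 s t y = of_real (
      4 * real s * real t * ((real 1)\<^sup>2 * y\<^sup>2 * (1 / 24 - sigma_moment 1 (x ^ 1)))
    + 4 * ((real (s * t))\<^sup>2 * y\<^sup>2 * (1 / 24 - sigma_moment 1 (x ^ (s * t))))
    + real t * ((real (2 * s))\<^sup>2 * y\<^sup>2 * (1 / 24 - sigma_moment 1 (x ^ (2 * s))))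
    + real s * ((real (2 * t))\<^sup>2 * y\<^sup>2 * (1 / 24 - sigma_moment 1 (x ^ (2 * t))))
    - real s * real t * ((real 2)\<^sup>2 * y\<^sup>2 * (1 / 24 - sigma_moment 1 (x ^ 2)))
    - (real (2 * s * t))\<^sup>2 * y\<^sup>2 * (1 / 24 - sigma_moment 1 (x ^ (2 * s * t)))
    - 4 * real t * ((real s)\<^sup>2 * y\<^sup>2 * (1 / 24 - sigma_moment 1 (x ^ s)))
    - 4 * real s * ((real t)\<^sup>2 * y\<^sup>2 * (1 / 24 - sigma_moment 1 (x ^ t))))"
    unfolding b_def Let_def using assms
    by (simp only: mu nat_0_less_mult_iff zero_less_one zero_less_numeral simp_thms
        of_real_add of_real_diff of_real_mult of_real_numeral of_real_of_nat_eq)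
  also have "\<dots> = of_real (- 2 * real s * real t * y\<^sup>2 * moment 1 s t y)"
    unfolding moment_eq[OF assms, of 1] x_def[symmetric]
    by (intro arg_cong[of _ _ of_real]) (simp add: algebra_simps power2_eq_square)
  finally show ?thesis .
qed

lemma b_2_eq:
  assumes "coprime s t" "s > 0" "t > 0" "y > 0"
  shows "b 2 s t y = of_real (4 * pi * real s * real t * y ^ 3 * moment 2 s t y)"
proof -
  define x where "x = exp (- 2 * pi * y)"
  have mu: "mu 2 (of_nat k * (\<i> * of_real y)) = of_real (2 * pi * (real k) ^ 3 * y ^ 3 * sigma_moment 2 (x ^ k))"
    if "k > 0" for k using mu_2_imaginary_axis[OF that assms(4)] by (simp only: x_def)
  have "b 2 s t y = of_real (
      4 * real s * real t * (2 * pi * (real 1) ^ 3 * y ^ 3 * (sigma_moment 2 (x ^ 1)))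
    + 4 * (2 * pi * (real (s * t)) ^ 3 * y ^ 3 * (sigma_moment 2 (x ^ (s * t))))
    + real t * (2 * pi * (real (2 * s)) ^ 3 * y ^ 3 * (sigma_moment 2 (x ^ (2 * s))))
    + real s * (2 * pi * (real (2 * t)) ^ 3 * y ^ 3 * (sigma_moment 2 (x ^ (2 * t))))
    - real s * real t * (2 * pi * (real 2) ^ 3 * y ^ 3 * (sigma_moment 2 (x ^ 2)))
    - 2 * pi * (real (2 * s * t)) ^ 3 * y ^ 3 * (sigma_moment 2 (x ^ (2 * s * t)))
    - 4 * real t * (2 * pi * (real s) ^ 3 * y ^ 3 * (sigma_moment 2 (x ^ s)))
    - 4 * real s * (2 * pi * (real t) ^ 3 * y ^ 3 * (sigma_moment 2 (x ^ t))))"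
    unfolding b_def Let_def using assms
    by (simp only: mu nat_0_less_mult_iff zero_less_one zero_less_numeral simp_thms
        of_real_add of_real_diff of_real_mult of_real_numeral of_real_of_nat_eq)
  also have "\<dots> = of_real (4 * pi * real s * real t * y ^ 3 * moment 2 s t y)"
    unfolding moment_eq[OF assms, of 2] x_def[symmetric]
    by (intro arg_cong[of _ _ of_real]) (simp add: algebra_simps power2_eq_square power3_eq_cube)
  finally show ?thesis .
qed

lemma H_imaginary_axis:
  assumes "coprime s t" "s > 0" "t > 0" "y > 0"
  shows "H (\<i> * of_real y) s t = of_real (exp (moment 0 s t y))"
proof -
  define x where "x = exp (- 2 * pi * y)"
  define P where "P = sigma_moment 0"
  have eta: "dedekind_eta (of_nat k * (\<i> * of_real y)) = of_real (exp (- pi * real k * y / 12 - P (x ^ k)))"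
    if "k > 0" for k
  proof -
    have "power_sum sigma_inv (complex_of_real (exp (- 2 * pi * y) ^ k)) = of_real (P (x ^ k))"
      using sigma_moment_complex[OF that assms(4), of 0] by (simp only: power_0 mult_1 P_def x_def)
    then have "log_eta (of_nat k * (\<i> * of_real y)) = of_real (- pi * real k * y / 12 - P (x ^ k))"
      using that assms by (subst log_eta_eq) (simp_all only: exp_imaginary_axis, simp_all add: algebra_simps)
    then show ?thesis
      using exp_log_eta[of "of_nat k * (\<i> * of_real y)"] that assms by (simp add: exp_of_real del: of_real_diff)
  qed
  have args: "2 * (\<i> * of_real y) = of_nat 2 * (\<i> * of_real y)" "\<i> * of_real y = of_nat 1 * (\<i> * of_real y)"
    "2 * of_nat s * of_nat t * (\<i> * of_real y) = of_nat (2 * (s * t)) * (\<i> * of_real y)"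
    "of_nat s * of_nat t * (\<i> * of_real y) = of_nat (s * t) * (\<i> * of_real y)"
    "2 * of_nat s * (\<i> * of_real y) = of_nat (2 * s) * (\<i> * of_real y)"
    "2 * of_nat t * (\<i> * of_real y) = of_nat (2 * t) * (\<i> * of_real y)"
    by simp_all
  define E where "E = (\<lambda>k. exp (- pi * real k * y / 12 - P (x ^ k)))"
  have eta1: "dedekind_eta (\<i> * of_real y) = of_real (E 1)" using eta[of 1] by (simp add: E_def)
  have eta': "dedekind_eta (of_nat k * (\<i> * of_real y)) = of_real (E k)" if "k > 0" for k
    using eta[OF that] by (simp only: E_def)
  have "H (\<i> * of_real y) s t = of_real ((E 2 * E (2 * (s * t)) * (E s)\<^sup>2 * (E t)\<^sup>2)
      / ((E 1)\<^sup>2 * (E (s * t))\<^sup>2 * E (2 * s) * E (2 * t)))"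
    unfolding H_def args(1,3-6) eta1 using assms
    by (simp only: eta' nat_0_less_mult_iff zero_less_one zero_less_numeral simp_thms
        of_real_mult of_real_divide of_real_power)
  also have "(E 2 * E (2 * (s * t)) * (E s)\<^sup>2 * (E t)\<^sup>2) / ((E 1)\<^sup>2 * (E (s * t))\<^sup>2 * E (2 * s) * E (2 * t))
     = exp (moment 0 s t y)"
    unfolding moment_eq[OF assms, of 0] x_def[symmetric] P_def[symmetric] E_def power2_eq_square exp_add[symmetric] exp_diff[symmetric]
    by (intro arg_cong[of _ _ exp]) (simp add: algebra_simps)
  finally show ?thesis .
qed

section \<open>The generating function away from the positive real axis\<close>

text \<open>The value of \<open>\<Sum>m. r ^ m * (1 - cos (m * \<theta>))\<close> as a function of \<open>w = 1 - cos \<theta>\<close>. It is increasing in \<open>w\<close>,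
  which the trigonometric form hides.\<close>

definition cosine_kernel :: "real \<Rightarrow> real \<Rightarrow> real" where
  "cosine_kernel r w = r * (1 + r) * w / ((1 - r) * ((1 - r)\<^sup>2 + 2 * r * w))"

text \<open>The sum is \<open>1 / (1 - r) - Re (1 / (1 - q))\<close> with \<open>q = r * exp (\<i> \<theta>)\<close>, and
  \<open>(cmod (1 - q))\<^sup>2 = (1 - r)\<^sup>2 + 2 * r * (1 - cos \<theta>)\<close>.\<close>

lemma cosine_kernel_sums:
  assumes "0 \<le> r" "r < 1"
  shows "(\<lambda>m. r ^ m * (1 - cos (real m * \<theta>))) sums cosine_kernel r (1 - cos \<theta>)"
proof -
  define q where "q = of_real r * exp (\<i> * of_real \<theta>)"
  have nq: "norm q < 1" using assms by (simp add: q_def norm_mult)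
  have pw: "q ^ m = of_real (r ^ m) * exp (\<i> * of_real (real m * \<theta>))" for m
    by (simp add: q_def power_mult_distrib exp_of_nat_mult[symmetric] mult_ac)
  have "(\<lambda>m. Re (q ^ m)) sums Re (1 / (1 - q))"
    by (intro sums_Re geometric_sums nq)
  then have "(\<lambda>m. r ^ m - Re (q ^ m)) sums (1 / (1 - r) - Re (1 / (1 - q)))"
    using assms by (intro sums_diff geometric_sums) auto
  moreover have "(\<lambda>m. r ^ m - Re (q ^ m)) = (\<lambda>m. r ^ m * (1 - cos (real m * \<theta>)))"
    unfolding pw by (simp add: algebra_simps Re_exp)
  moreover have "1 / (1 - r) - Re (1 / (1 - q)) = cosine_kernel r (1 - cos \<theta>)"
  proof -
    define c where "c = cos \<theta>"
    have Re: "Re q = r * c" and Im: "Im q = r * sin \<theta>"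
      by (simp_all add: q_def Re_exp Im_exp c_def)
    have "(1 - Re q)\<^sup>2 + (Im q)\<^sup>2 = 1 - 2 * r * c + r\<^sup>2 * (c\<^sup>2 + (sin \<theta>)\<^sup>2)"
      by (simp add: Re Im power2_eq_square algebra_simps)
    then have nrm: "(1 - Re q)\<^sup>2 + (Im q)\<^sup>2 = (1 - r)\<^sup>2 + 2 * r * (1 - c)"
      by (simp add: c_def power2_eq_square algebra_simps)
    have c1: "1 - c \<ge> 0" by (simp add: c_def)
    have pos: "(1 - r)\<^sup>2 + 2 * r * (1 - c) > 0"
      using assms c1 by (intro add_pos_nonneg) auto
    have "Re (1 / (1 - q)) = (1 - r * c) / ((1 - r)\<^sup>2 + 2 * r * (1 - c))"
      unfolding nrm[symmetric] by (simp add: Re_divide Re)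
    moreover have "1 / (1 - r) - (1 - r * c) / D = r * (1 + r) * (1 - c) / ((1 - r) * D)"
      if D: "D = (1 - r)\<^sup>2 + 2 * r * (1 - c)" "D > 0" for D
    proof -
      have "1 / (1 - r) - (1 - r * c) / D = (D - (1 - r) * (1 - r * c)) / ((1 - r) * D)"
        using assms D(2) by (simp add: diff_frac_eq mult_ac)
      also have "D - (1 - r) * (1 - r * c) = r * (1 + r) * (1 - c)"
        by (simp add: D(1) power2_eq_square algebra_simps)
      finally show ?thesis .
    qed
    ultimately show ?thesis using pos by (simp add: cosine_kernel_def c_def)
  qed
  ultimately show ?thesis by simp
qed

lemma abs_sin_mult_le: "\<bar>sin (real n * x)\<bar> \<le> real n * \<bar>sin x\<bar>"
proof (induction n)
  case (Suc n)
  have "\<bar>sin (real (Suc n) * x)\<bar> = \<bar>sin (real n * x) * cos x + cos (real n * x) * sin x\<bar>"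
    by (simp add: algebra_simps sin_add)
  also have "\<dots> \<le> \<bar>sin (real n * x)\<bar> * \<bar>cos x\<bar> + \<bar>cos (real n * x)\<bar> * \<bar>sin x\<bar>"
    by (metis abs_mult abs_triangle_ineq)
  also have "\<dots> \<le> \<bar>sin (real n * x)\<bar> * 1 + 1 * \<bar>sin x\<bar>"
    by (intro add_mono mult_left_mono mult_right_mono) auto
  finally show ?case using Suc by (simp add: algebra_simps)
qed simp

lemma one_minus_cos: "1 - cos x = 2 * (sin (x / 2))\<^sup>2" for x :: real
  using cos_double_sin[of "x / 2"] by simp

lemma one_minus_cos_mult_le: "1 - cos (real n * \<theta>) \<le> (real n)\<^sup>2 * (1 - cos \<theta>)"
proof -
  have "(sin (real n * (\<theta> / 2)))\<^sup>2 \<le> (real n * \<bar>sin (\<theta> / 2)\<bar>)\<^sup>2"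
    using abs_sin_mult_le[of n "\<theta> / 2"] by (metis abs_ge_zero power2_abs power_mono)
  then show ?thesis by (simp add: one_minus_cos power_mult_distrib)
qed

lemma cosine_kernel_mono:
  assumes "0 \<le> r" "r < 1" "0 \<le> w" "w \<le> w'"
  shows "cosine_kernel r w \<le> cosine_kernel r w'"
proof -
  have pos: "(1 - r)\<^sup>2 + 2 * r * w > 0" "(1 - r)\<^sup>2 + 2 * r * w' > 0"
    using assms by (auto intro!: add_pos_nonneg)
  have "w * ((1 - r)\<^sup>2 + 2 * r * w') \<le> w' * ((1 - r)\<^sup>2 + 2 * r * w)"
    using assms by (simp add: distrib_left mult_right_mono)
  then have "w / ((1 - r)\<^sup>2 + 2 * r * w) \<le> w' / ((1 - r)\<^sup>2 + 2 * r * w')"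
    by (simp only: pos_divide_le_eq[OF pos(1)] pos_le_divide_eq[OF pos(2)] times_divide_eq_left)
  then have "r * (1 + r) / (1 - r) * (w / ((1 - r)\<^sup>2 + 2 * r * w)) \<le> r * (1 + r) / (1 - r) * (w' / ((1 - r)\<^sup>2 + 2 * r * w'))"
    using assms by (intro mult_left_mono) auto
  then show ?thesis by (simp add: cosine_kernel_def)
qed

definition geometric_sum :: "nat \<Rightarrow> real \<Rightarrow> real" where
  "geometric_sum s r = (\<Sum>i<s. r ^ i)"

text \<open>Pairing \<open>r ^ i\<close> with \<open>r ^ (s - 1 - i)\<close>, the arithmetic-geometric mean inequality bounds each pair below by
  \<open>2 * sqrt r ^ (s - 1)\<close>.\<close>

lemma geometric_sum_ge:
  assumes "0 \<le> r"
  shows "(real s)\<^sup>2 * r ^ (s - 1) \<le> (geometric_sum s r)\<^sup>2"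
proof -
  define x where "x = sqrt r"
  have x: "x \<ge> 0" "r = x\<^sup>2" using assms by (auto simp: x_def)
  have "2 * x ^ (s - 1) \<le> r ^ i + r ^ (s - 1 - i)" if "i < s" for i
  proof -
    have "x ^ (s - 1) = x ^ i * x ^ (s - 1 - i)" using that by (simp flip: power_add)
    then have "r ^ i + r ^ (s - 1 - i) - 2 * x ^ (s - 1) = (x ^ i - x ^ (s - 1 - i))\<^sup>2"
      by (simp add: x(2) power2_diff flip: power_mult mult.commute)
    then show ?thesis by (metis diff_ge_0_iff_ge zero_le_power2)
  qed
  then have "(\<Sum>i<s. 2 * x ^ (s - 1)) \<le> (\<Sum>i<s. r ^ i + r ^ (s - 1 - i))"
    by (intro sum_mono) auto
  also have "\<dots> = 2 * geometric_sum s r"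
    unfolding sum.distrib geometric_sum_def using sum.nat_diff_reindex[of "\<lambda>i. r ^ i" s] by simp
  finally have "real s * x ^ (s - 1) \<le> geometric_sum s r" by simp
  then have "(real s * x ^ (s - 1))\<^sup>2 \<le> (geometric_sum s r)\<^sup>2"
    using x by (intro power_mono) auto
  then show ?thesis by (simp add: power_mult_distrib x(2) flip: power_mult mult.commute)
qed

text \<open>The multiples of \<open>s\<close> carry at most the proportion \<open>1 / geometric_sum s r\<close> of the whole sum, at every
  angle. The point is uniformity: near a fraction with denominator \<open>s\<close> the sum over multiples of \<open>s\<close> is
  small while the full sum is large, and near \<open>0\<close> both degenerate at the same rate. Replace
  \<open>1 - cos (s * \<theta>)\<close> by the larger \<open>s\<^sup>2 * (1 - cos \<theta>)\<close>, use monotonicity of the kernel, write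
  \<open>1 - r ^ s = (1 - r) * geometric_sum s r\<close>, and bound the square of the latter below.\<close>

lemma cosine_kernel_dilate_le:
  assumes r: "0 < r" "r < 1" and s: "s > 0"
  shows "cosine_kernel (r ^ s) (1 - cos (real s * \<theta>)) \<le> cosine_kernel r (1 - cos \<theta>) / geometric_sum s r"
proof -
  define \<sigma> R w where "\<sigma> = geometric_sum s r" and "R = r ^ s" and "w = 1 - cos \<theta>"
  define D where "D = (1 - r)\<^sup>2 + 2 * r * w"
  have w: "w \<ge> 0" by (simp add: w_def)
  have D: "D > 0" unfolding D_def using r w by (intro add_pos_nonneg) auto
  have R: "R = r * r ^ (s - 1)" using s by (cases s) (auto simp: R_def)
  have R1: "0 < R" "R \<le> r" "R < 1" using r s
    by (auto simp: R_def power_le_one_iff intro: power_less_one_iff[THEN iffD2])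
      (metis R R_def mult.right_neutral mult_left_mono less_imp_le power_le_one)
  have \<sigma>: "\<sigma> > 0" unfolding \<sigma>_def geometric_sum_def using r s by (intro sum_pos) auto
  have R\<sigma>: "1 - R = (1 - r) * \<sigma>"
    unfolding \<sigma>_def geometric_sum_def R_def using one_diff_power_eq[of r s] by simp
  have "cosine_kernel R (1 - cos (real s * \<theta>)) \<le> cosine_kernel R ((real s)\<^sup>2 * w)"
    using R1 one_minus_cos_mult_le[of s \<theta>] by (intro cosine_kernel_mono) (auto simp: w_def)
  also have "\<dots> = R * (1 + R) * (real s)\<^sup>2 * w / ((1 - r) * \<sigma> * (((1 - r) * \<sigma>)\<^sup>2 + 2 * R * (real s)\<^sup>2 * w))"
    by (simp add: cosine_kernel_def R\<sigma> mult_ac)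
  also have "\<dots> \<le> R * (1 + R) * (real s)\<^sup>2 * w / ((1 - r) * \<sigma> * ((real s)\<^sup>2 * r ^ (s - 1) * D))"
  proof (rule divide_left_mono)
    have "(1 - r)\<^sup>2 * ((real s)\<^sup>2 * r ^ (s - 1)) \<le> (1 - r)\<^sup>2 * \<sigma>\<^sup>2"
      unfolding \<sigma>_def using r by (intro mult_left_mono geometric_sum_ge) auto
    then have "(real s)\<^sup>2 * r ^ (s - 1) * D \<le> ((1 - r) * \<sigma>)\<^sup>2 + 2 * R * (real s)\<^sup>2 * w"
      by (simp add: D_def R power_mult_distrib distrib_left mult_ac)
    then show "(1 - r) * \<sigma> * ((real s)\<^sup>2 * r ^ (s - 1) * D) \<le> (1 - r) * \<sigma> * (((1 - r) * \<sigma>)\<^sup>2 + 2 * R * (real s)\<^sup>2 * w)"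
      using r \<sigma> by (intro mult_left_mono) auto
    show "0 \<le> R * (1 + R) * (real s)\<^sup>2 * w" using R1 w by simp
    show "0 < (1 - r) * \<sigma> * (((1 - r) * \<sigma>)\<^sup>2 + 2 * R * (real s)\<^sup>2 * w) * ((1 - r) * \<sigma> * ((real s)\<^sup>2 * r ^ (s - 1) * D))"
      using r \<sigma> R1 w D s by (intro mult_pos_pos add_pos_nonneg) auto
  qed
  also have "\<dots> = r * (1 + R) * w / ((1 - r) * \<sigma> * D)"
    using r s unfolding R by simp
  also have "\<dots> \<le> r * (1 + r) * w / ((1 - r) * \<sigma> * D)"
    using r R1 w \<sigma> D by (intro divide_right_mono mult_right_mono mult_left_mono) auto
  also have "\<dots> = cosine_kernel r w / \<sigma>"
    by (simp add: cosine_kernel_def D_def mult_ac)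
  finally show ?thesis by (simp add: R_def w_def \<sigma>_def)
qed

lemma cosine_kernel_dilate_sums:
  assumes "0 \<le> r" "r < 1" "s > 0"
  shows "(\<lambda>m. if s dvd m then r ^ m * (1 - cos (real m * \<theta>)) else 0) sums
     cosine_kernel (r ^ s) (1 - cos (real s * \<theta>))"
proof -
  have "r ^ s < 1" using assms by (subst power_less_one_iff) auto
  then have "(\<lambda>m. (r ^ s) ^ m * (1 - cos (real m * (real s * \<theta>)))) sums cosine_kernel (r ^ s) (1 - cos (real s * \<theta>))"
    using assms by (intro cosine_kernel_sums) auto
  moreover have "(\<lambda>m. (r ^ s) ^ m * (1 - cos (real m * (real s * \<theta>)))) =
     (\<lambda>m. if s dvd s * m then r ^ (s * m) * (1 - cos (real (s * m) * \<theta>)) else 0)"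
    by (simp add: mult_ac flip: power_mult)
  moreover have "strict_mono (\<lambda>m. s * m)" using assms by (simp add: strict_mono_def)
  moreover have "(if s dvd n then r ^ n * (1 - cos (real n * \<theta>)) else 0) = 0" if "n \<notin> range (\<lambda>m. s * m)" for n
    using that by (auto simp: dvd_def)
  ultimately show ?thesis
    using sums_mono_reindex[of "\<lambda>m. s * m" "\<lambda>m. if s dvd m then r ^ m * (1 - cos (real m * \<theta>)) else 0"]
    by simp
qed

text \<open>This is where \<open>s, t \<ge> 10\<close> enters the estimate: together, the multiples of \<open>s\<close> and of \<open>t\<close> may remove
  only half of the full sum.\<close>

lemma geometric_sum_ge_4:
  assumes "y > 0" "y \<le> 1 / 200" "s \<ge> 10"
  shows "geometric_sum s (exp (- 2 * pi * y)) \<ge> 4"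
proof -
  define r where "r = exp (- 2 * pi * y)"
  have r: "r > 0" "r \<le> 1" using assms by (auto simp: r_def)
  have "pi * y \<le> 4 * (1 / 200)" using assms pi_less_4 by (intro mult_mono) auto
  then have "r ^ 9 \<ge> 1 - 9 * (2 * (4 / 200))"
    using exp_ge_add_one_self[of "- (18 * (pi * y))"] by (simp add: r_def exp_of_nat_mult[symmetric])
  then have "4 \<le> 10 * r ^ 9" by simp
  also have "\<dots> = (\<Sum>i<10::nat. r ^ 9)" by simp
  also have "\<dots> \<le> (\<Sum>i<10::nat. r ^ i)" using r by (intro sum_mono power_decreasing) auto
  also have "\<dots> \<le> (\<Sum>i<s. r ^ i)" using r assms by (intro sum_mono2) auto
  finally show ?thesis by (simp add: geometric_sum_def r_def)
qed

lemma log_coeff_cosine_summable: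
  assumes "y > 0"
  shows "summable (\<lambda>m. log_coeff s t m * exp (- 2 * pi * y) ^ m * (1 - cos (real m * \<theta>)))"
proof (rule summable_comparison_test')
  show "summable (\<lambda>m. 2 * norm (of_real (log_coeff s t m) * exp (- 2 * pi * y) ^ m))"
    using summable_power_sum[OF poly_growth_log_coeff, of "exp (- 2 * pi * y)" s t] assms
    by (intro summable_mult) auto
  fix m
  have "\<bar>1 - cos (real m * \<theta>)\<bar> \<le> 2" using cos_ge_minus_one[of "real m * \<theta>"] by (simp add: abs_le_iff)
  then show "norm (log_coeff s t m * exp (- 2 * pi * y) ^ m * (1 - cos (real m * \<theta>)))
      \<le> 2 * norm (of_real (log_coeff s t m) * exp (- 2 * pi * y) ^ m)"
    unfolding norm_mult by (simp add: mult.commute[of 2] mult_left_mono)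
qed

text \<open>The logarithm of the ratio of \<open>H\<close> on the positive real axis to its absolute value at angle \<open>\<theta>\<close>, both on
  the circle of radius \<open>exp (- 2 \<pi> y)\<close> in the variable \<open>q\<close>.\<close>

definition cosine_deficit :: "nat \<Rightarrow> nat \<Rightarrow> real \<Rightarrow> real \<Rightarrow> real" where
  "cosine_deficit s t y \<theta> = (\<Sum>m. log_coeff s t m * exp (- 2 * pi * y) ^ m * (1 - cos (real m * \<theta>)))"

text \<open>Only the divisor \<open>d = 1\<close> is kept, so that \<open>log_coeff\<close> is at least twice the indicator of the allowed
  integers. All integers, minus the multiples of \<open>s\<close>, minus the multiples of \<open>t\<close>, retain at least half of
  the full sum.\<close>

lemma cosine_deficit_ge_kernel:
  assumes "y > 0" "y \<le> 1 / 200" "s \<ge> 10" "t \<ge> 10"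
  shows "cosine_deficit s t y \<theta> \<ge> cosine_kernel (exp (- 2 * pi * y)) (1 - cos \<theta>)"
proof -
  define r where "r = exp (- 2 * pi * y)"
  have r: "0 < r" "r < 1" using assms by (auto simp: r_def)
  define K where "K = cosine_kernel r (1 - cos \<theta>)"
  define f where "f = (\<lambda>m. r ^ m * (1 - cos (real m * \<theta>)))"
  have f: "f m \<ge> 0" for m using r by (simp add: f_def)
  have K: "K \<ge> 0"
    using sums_le[of "\<lambda>_. 0" f 0 K] cosine_kernel_sums[of r \<theta>] r f by (simp add: f_def K_def)
  have mult: "cosine_kernel (r ^ k) (1 - cos (real k * \<theta>)) \<le> K / 4" if "k \<ge> 10" for k
  proof -
    have "cosine_kernel (r ^ k) (1 - cos (real k * \<theta>)) \<le> K / geometric_sum k r"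
      unfolding K_def using that r by (intro cosine_kernel_dilate_le) auto
    also have "\<dots> \<le> K / 4"
      using geometric_sum_ge_4[OF assms(1,2) that] K by (intro divide_left_mono) (auto simp: r_def)
    finally show ?thesis .
  qed
  have "(\<lambda>m. 2 * (f m - (if s dvd m then f m else 0) - (if t dvd m then f m else 0))) sums
     (2 * (K - cosine_kernel (r ^ s) (1 - cos (real s * \<theta>)) - cosine_kernel (r ^ t) (1 - cos (real t * \<theta>))))"
    unfolding f_def K_def using r assms
    by (intro sums_mult sums_diff cosine_kernel_sums cosine_kernel_dilate_sums) auto
  moreover have "(\<lambda>m. log_coeff s t m * r ^ m * (1 - cos (real m * \<theta>))) sums cosine_deficit s t y \<theta>"
    unfolding cosine_deficit_def r_def by (intro summable_sums log_coeff_cosine_summable assms)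
  moreover have "2 * (f m - (if s dvd m then f m else 0) - (if t dvd m then f m else 0))
      \<le> log_coeff s t m * r ^ m * (1 - cos (real m * \<theta>))" for m
  proof (cases "allowed s t m")
    case True
    then have "2 * f m \<le> log_coeff s t m * f m" using f by (intro mult_right_mono log_coeff_ge)
    then show ?thesis using True by (simp add: allowed_def f_def mult.assoc)
  next
    case False
    have "0 \<le> log_coeff s t m * f m" using f log_coeff_nonneg by simp
    then show ?thesis using False f[of m] by (auto simp: allowed_def f_def mult.assoc)
  qed
  ultimately have "2 * (K - cosine_kernel (r ^ s) (1 - cos (real s * \<theta>)) - cosine_kernel (r ^ t) (1 - cos (real t * \<theta>)))
     \<le> cosine_deficit s t y \<theta>"
    by (rule sums_le[rotated])
  then show ?thesis using mult[OF assms(3)] mult[OF assms(4)] by (simp add: K_def r_def)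
qed

text \<open>Monotonicity of the kernel reduces to \<open>w = \<kappa> * y\<^sup>2\<close>, where \<open>1 - r \<le> 2 * \<pi> * y\<close> makes the denominator of
  order \<open>y ^ 3\<close>.\<close>

lemma cosine_deficit_ge:
  assumes "y > 0" "y \<le> 1 / 200" "s \<ge> 10" "t \<ge> 10" "\<kappa> > 0" "1 - cos \<theta> \<ge> \<kappa> * y\<^sup>2"
  shows "cosine_deficit s t y \<theta> \<ge> \<kappa> / (2 * pi * (4 * pi\<^sup>2 + 2 * \<kappa>)) / y"
proof -
  define r where "r = exp (- 2 * pi * y)"
  have r: "0 < r" "r < 1" using assms by (auto simp: r_def)
  have "pi * y \<le> 4 * (1 / 200)" using assms pi_less_4 by (intro mult_mono) auto
  then have "r \<ge> 9 / 10" using exp_ge_add_one_self[of "- 2 * pi * y"] by (simp add: r_def)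
  then have "r * (1 + r) \<ge> 9 / 10 * (1 + 9 / 10)" by (intro mult_mono) auto
  then have r1: "r * (1 + r) \<ge> 1" by simp
  have r2: "1 - r \<le> 2 * pi * y" using exp_ge_add_one_self[of "- 2 * pi * y"] by (simp add: r_def)
  have den: "(1 - r) * ((1 - r)\<^sup>2 + 2 * r * (\<kappa> * y\<^sup>2)) \<le> 2 * pi * y * ((2 * pi * y)\<^sup>2 + 2 * 1 * (\<kappa> * y\<^sup>2))"
    using r r2 assms by (intro mult_mono add_mono power_mono) auto
  have den0: "0 < (1 - r) * ((1 - r)\<^sup>2 + 2 * r * (\<kappa> * y\<^sup>2))"
    using r assms by (intro mult_pos_pos add_pos_nonneg) auto
  have "\<kappa> / (2 * pi * (4 * pi\<^sup>2 + 2 * \<kappa>)) / y = (\<kappa> * y\<^sup>2) / (2 * pi * y * ((2 * pi * y)\<^sup>2 + 2 * 1 * (\<kappa> * y\<^sup>2)))"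
  proof -
    have "2 * pi * y * ((2 * pi * y)\<^sup>2 + 2 * 1 * (\<kappa> * y\<^sup>2)) = (2 * pi * (4 * pi\<^sup>2 + 2 * \<kappa>) * y) * y\<^sup>2"
      by (simp add: power2_eq_square algebra_simps)
    then show ?thesis using assms by simp
  qed
  also have "\<dots> \<le> r * (1 + r) * (\<kappa> * y\<^sup>2) / (2 * pi * y * ((2 * pi * y)\<^sup>2 + 2 * 1 * (\<kappa> * y\<^sup>2)))"
    using mult_right_mono[OF r1, of "\<kappa> * y\<^sup>2"] assms by (intro divide_right_mono) auto
  also have "\<dots> \<le> r * (1 + r) * (\<kappa> * y\<^sup>2) / ((1 - r) * ((1 - r)\<^sup>2 + 2 * r * (\<kappa> * y\<^sup>2)))"
    using den den0 r assms by (intro divide_left_mono) (auto intro: mult_pos_pos)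
  also have "\<dots> = cosine_kernel r (\<kappa> * y\<^sup>2)" by (simp add: cosine_kernel_def)
  also have "\<dots> \<le> cosine_kernel r (1 - cos \<theta>)" using r assms by (intro cosine_kernel_mono) auto
  also have "\<dots> \<le> cosine_deficit s t y \<theta>" unfolding r_def by (rule cosine_deficit_ge_kernel) fact+
  finally show ?thesis .
qed

lemma cos_taylor_4: "cos x \<le> 1 - x\<^sup>2 / 2 + x ^ 4 / 24" for x :: real
proof -
  have "\<bar>Re (iexp x - (\<Sum>k\<le>3. (\<i> * x) ^ k / fact k))\<bar> \<le> \<bar>x\<bar> ^ Suc 3 / fact (Suc 3)"
    by (rule order.trans[OF abs_Re_le_cmod iexp_approx1])
  moreover have "Re (\<Sum>k\<le>3. (\<i> * x) ^ k / fact k) = 1 - x\<^sup>2 / 2"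
    by (simp add: eval_nat_numeral Re_divide_numeral)
  moreover have "\<bar>x\<bar> ^ Suc 3 = x ^ 4" using power_even_abs[of 4 x] by simp
  moreover have "fact (Suc 3) = (24 :: real)" by (simp add: fact_numeral)
  ultimately have "\<bar>cos x - (1 - x\<^sup>2 / 2)\<bar> \<le> x ^ 4 / 24" by (simp only: minus_complex.sel) (simp add: Re_exp)
  then show ?thesis by linarith
qed

lemma one_minus_cos_ge:
  fixes x :: real
  assumes "\<bar>x\<bar> \<le> pi" shows "1 - cos x \<ge> x\<^sup>2 / 12"
proof -
  have "x\<^sup>2 \<le> (22/7)\<^sup>2"
    using assms pi_approx by (intro power2_le_iff_abs_le[THEN iffD2]) auto
  then have "x\<^sup>2 * x\<^sup>2 \<le> 10 * x\<^sup>2" by (intro mult_right_mono) (auto simp: power2_eq_square)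
  then show ?thesis using cos_taylor_4[of x] by (simp add: eval_nat_numeral)
qed

lemma one_minus_cos_le: "1 - cos x \<le> x\<^sup>2 / 2" for x :: real
proof -
  have "(sin (x / 2))\<^sup>2 \<le> (x / 2)\<^sup>2"
    using abs_sin_x_le_abs_x[of "x / 2"] by (simp only: abs_le_square_iff)
  then show ?thesis by (simp add: one_minus_cos power_divide)
qed

section \<open>Size and monotonicity of the moments\<close>

lemma sum_inverse_squares_le: "(\<Sum>d=1..M. 1 / (real d)\<^sup>2) \<le> 2"
proof -
  have "(\<Sum>d=1..Suc n. 1 / (real d)\<^sup>2) \<le> 2 - 1 / real (Suc n)" for n
  proof (induction n)
    case (Suc n)
    have "1 / (real (Suc (Suc n)))\<^sup>2 \<le> 1 / (real (Suc n) * real (Suc (Suc n)))"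
      by (intro divide_left_mono) (auto simp: power2_eq_square intro!: mult_right_mono mult_pos_pos)
    also have "\<dots> = 1 / real (Suc n) - 1 / real (Suc (Suc n))"
      by (simp add: field_simps)
    finally show ?case using Suc by simp
  qed simp
  then have bound: "(\<Sum>d=1..Suc n. 1 / (real d)\<^sup>2) \<le> 2" for n
    by (rule order.trans) simp
  show ?thesis
  proof (cases M)
    case (Suc n)
    show ?thesis unfolding Suc by (rule bound)
  qed simp
qed

text \<open>Exchanging the order of summation gives \<open>\<Sum>d. (1 / d) * \<rho> ^ d / (1 - \<rho> ^ d)\<close>. By Bernoulli's inequality
  \<open>(1 / \<rho>) ^ d - 1 \<ge> d * (1 / \<rho> - 1)\<close>, which supplies a second factor \<open>1 / d\<close> and makes the sum over \<open>d\<close>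
  converge; no logarithm is lost.\<close>

lemma sigma_inv_partial_sums_le:
  assumes "0 < \<rho>" "\<rho> < 1"
  shows "(\<Sum>m=1..M. sigma_inv m * \<rho> ^ m) \<le> 2 / (1 / \<rho> - 1)"
proof -
  define u where "u = 1 / \<rho> - 1"
  have u: "u > 0" using assms by (simp add: u_def)
  have "(\<Sum>m=1..M. sigma_inv m * \<rho> ^ m) = (\<Sum>m=1..M. \<Sum>d | d \<in> {1..M} \<and> d dvd m. \<rho> ^ m / real d)"
  proof (rule sum.cong)
    fix m assume "m \<in> {1..M}"
    then have "{d. d dvd m} = {d. d \<in> {1..M} \<and> d dvd m}"
      by (auto dest: dvd_imp_le dvd_pos_nat simp: Suc_le_eq)
    then show "sigma_inv m * \<rho> ^ m = (\<Sum>d | d \<in> {1..M} \<and> d dvd m. \<rho> ^ m / real d)"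
      by (simp add: sigma_inv_def sum_distrib_right)
  qed simp
  also have "\<dots> = (\<Sum>d=1..M. \<Sum>m | m \<in> {1..M} \<and> d dvd m. \<rho> ^ m / real d)"
    by (rule sum.swap_restrict) auto
  also have "\<dots> \<le> (\<Sum>d=1..M. 1 / (real d)\<^sup>2 * (1 / u))"
  proof (rule sum_mono)
    fix d assume "d \<in> {1..M}"
    then have d: "d > 0" by simp
    define x where "x = \<rho> ^ d"
    have x: "0 < x" "x < 1" using assms d by (auto simp: x_def power_less_one_iff)
    have "(\<Sum>m | m \<in> {1..M} \<and> d dvd m. \<rho> ^ m) \<le> (\<Sum>m\<in>(\<lambda>k. d * k) ` {1..M}. \<rho> ^ m)"
    proof (rule sum_mono2)
      show "{m. m \<in> {1..M} \<and> d dvd m} \<subseteq> (\<lambda>k. d * k) ` {1..M}"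
      proof
        fix m assume "m \<in> {m. m \<in> {1..M} \<and> d dvd m}"
        then obtain k where k: "m = d * k" "1 \<le> d * k" "d * k \<le> M" by auto
        have "1 \<le> k" using k by (cases k) auto
        moreover have "k \<le> d * k" using d by simp
        then have "k \<le> M" using k(3) by (rule le_trans)
        ultimately show "m \<in> (\<lambda>k. d * k) ` {1..M}" using k by (intro image_eqI[of _ _ k]) auto
      qed
    qed (use assms in auto)
    also have "\<dots> = (\<Sum>k=1..M. x ^ k)"
      using d by (subst sum.reindex) (auto simp: inj_on_def x_def power_mult)
    also have "\<dots> = x * (\<Sum>k<M. x ^ k)"
      unfolding sum_distrib_left One_nat_def sum.atLeast1_atMost_eq by simp
    also have "(\<Sum>k<M. x ^ k) \<le> 1 / (1 - x)"
      using x by (subst sum_gp_strict) (auto intro!: divide_right_mono)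
    also have "x * (1 / (1 - x)) = 1 / (1 / x - 1)" using x by (simp add: field_simps)
    also have "\<dots> \<le> 1 / (real d * u)"
    proof (rule divide_left_mono)
      have "1 + real d * u \<le> (1 + u) ^ d" using u by (intro Bernoulli_inequality) auto
      also have "\<dots> = 1 / x" by (simp add: u_def x_def power_one_over)
      finally show "real d * u \<le> 1 / x - 1" by simp
      then show "0 < (1 / x - 1) * (real d * u)"
        using u d x by (intro mult_pos_pos) (auto simp: field_simps)
    qed simp
    finally have "(\<Sum>m | m \<in> {1..M} \<and> d dvd m. \<rho> ^ m) \<le> 1 / (real d * u)" using x by simp
    then have "(\<Sum>m | m \<in> {1..M} \<and> d dvd m. \<rho> ^ m) / real d \<le> 1 / (real d * u) / real d"
      by (intro divide_right_mono) auto
    then show "(\<Sum>m | m \<in> {1..M} \<and> d dvd m. \<rho> ^ m / real d) \<le> 1 / (real d)\<^sup>2 * (1 / u)"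
      by (simp add: sum_divide_distrib power2_eq_square mult_ac)
  qed
  also have "\<dots> = (\<Sum>d=1..M. 1 / (real d)\<^sup>2) * (1 / u)" by (simp only: sum_distrib_right)
  also have "\<dots> \<le> 2 * (1 / u)" using u by (intro mult_right_mono sum_inverse_squares_le) auto
  finally show ?thesis by (simp add: u_def)
qed

lemma power_sum_sigma_inv_le:
  fixes v :: real
  assumes "v > 0" shows "power_sum sigma_inv (exp (- v)) \<le> 2 / v"
proof -
  define \<rho> where "\<rho> = exp (- v)"
  have \<rho>: "0 < \<rho>" "\<rho> < 1" using assms by (auto simp: \<rho>_def)
  have "1 / \<rho> - 1 \<ge> v" using exp_ge_add_one_self[of v] by (simp add: \<rho>_def exp_minus field_simps)
  then have bound: "2 / (1 / \<rho> - 1) \<le> 2 / v" using assms by (intro divide_left_mono) (auto intro: mult_pos_pos)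
  have "(\<Sum>m<n. sigma_inv m * \<rho> ^ m) \<le> 2 / v" for n
  proof -
    have "(\<Sum>m<n. sigma_inv m * \<rho> ^ m) \<le> (\<Sum>m\<in>insert 0 {1..n}. sigma_inv m * \<rho> ^ m)"
      using \<rho> sigma_inv_nonneg by (intro sum_mono2) auto
    also have "\<dots> = (\<Sum>m=1..n. sigma_inv m * \<rho> ^ m)" by (subst sum.insert) (auto simp: sigma_inv_def)
    finally show ?thesis using sigma_inv_partial_sums_le[OF \<rho>, of n] bound by linarith
  qed
  moreover have "summable (\<lambda>m. sigma_inv m * \<rho> ^ m)"
    using summable_power_sum'[OF poly_growth_sigma_inv, of \<rho>] \<rho> by simp
  ultimately show ?thesis unfolding power_sum_def \<rho>_def[symmetric]
    by (intro suminf_le_const) auto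
qed

text \<open>Half of the decay \<open>exp (- 2 * \<pi> * y * m)\<close> pays for \<open>m ^ j\<close>, the other half for the sum over \<open>m\<close>.\<close>

lemma moment_le:
  assumes "y > 0"
  shows "moment j s t y \<le> 4 * fact j / (pi * y) ^ Suc j"
proof -
  define v where "v = pi * y"
  have v: "v > 0" using assms by (simp add: v_def)
  define A where "A = fact j / v ^ j"
  have le: "real m ^ j * log_coeff s t m * exp (- 2 * pi * y) ^ m \<le> 2 * A * (sigma_inv m * exp (- v) ^ m)" for m
  proof -
    have "real m ^ j * log_coeff s t m * exp (- 2 * pi * y) ^ m
        = log_coeff s t m * (real m ^ j * exp (- 2 * v * real m))"
      by (simp add: v_def exp_of_nat_mult[symmetric] mult_ac)
    also have "\<dots> \<le> 2 * sigma_inv m * (A * exp (- v * real m))"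
      unfolding A_def using v log_coeff_nonneg log_coeff_le
      by (intro mult_mono power_times_exp_le) (auto simp: sigma_inv_nonneg)
    finally show ?thesis by (simp add: exp_of_nat_mult[symmetric] mult_ac)
  qed
  have S: "(\<lambda>m. 2 * A * (sigma_inv m * exp (- v) ^ m)) sums (2 * A * power_sum sigma_inv (exp (- v)))"
    unfolding power_sum_def using v summable_power_sum'[OF poly_growth_sigma_inv, of "exp (- v)"]
    by (intro sums_mult) (auto intro: summable_sums)
  have "moment j s t y \<le> 2 * A * power_sum sigma_inv (exp (- v))"
    by (rule sums_le[OF le moment_sums[OF assms] S])
  also have "\<dots> \<le> 2 * A * (2 / v)"
    using v by (intro mult_left_mono power_sum_sigma_inv_le) (auto simp: A_def)
  finally show ?thesis by (simp add: A_def v_def mult_ac)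
qed

lemma moment_ge_term:
  assumes "y > 0"
  shows "real m ^ j * log_coeff s t m * exp (- 2 * pi * y) ^ m \<le> moment j s t y"
proof -
  define f where "f = (\<lambda>m. real m ^ j * log_coeff s t m * exp (- 2 * pi * y) ^ m)"
  have "summable f" "moment j s t y = suminf f"
    using moment_sums[OF assms, of j s t] by (auto simp: sums_iff f_def)
  moreover have "f n \<ge> 0" for n using log_coeff_nonneg by (simp add: f_def)
  ultimately have "sum f {m} \<le> moment j s t y" using sum_le_suminf[of f "{m}"] by simp
  then show ?thesis by (simp add: f_def)
qed

lemma moment_pos:
  assumes "y > 0" "s > 1" "t > 1" shows "moment j s t y > 0"
proof -
  have "allowed s t 1" using assms by (simp add: allowed_def)
  then have "0 < real 1 ^ j * log_coeff s t 1 * exp (- 2 * pi * y) ^ 1"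
    using log_coeff_ge[of s t 1] by simp
  then show ?thesis using moment_ge_term[OF assms(1), of 1 j s t] by linarith
qed

lemma moment_strict_decreasing:
  assumes "0 < y" "y < y'" "s > 1" "t > 1" shows "moment j s t y' < moment j s t y"
proof -
  define r r' where "r = exp (- 2 * pi * y)" and "r' = exp (- 2 * pi * y')"
  have r: "0 < r'" "r' < r" using assms by (auto simp: r_def r'_def)
  have al: "allowed s t 1" using assms by (simp add: allowed_def)
  have d: "(\<lambda>m. real m ^ j * log_coeff s t m * (r ^ m - r' ^ m)) sums (moment j s t y - moment j s t y')"
    using sums_diff[OF moment_sums[of y j s t] moment_sums[of y' j s t]] assms
    by (simp add: algebra_simps r_def r'_def)
  have "0 < (\<Sum>m. real m ^ j * log_coeff s t m * (r ^ m - r' ^ m))"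
  proof (rule suminf_pos2[of _ 1])
    show "0 \<le> real m ^ j * log_coeff s t m * (r ^ m - r' ^ m)" for m
      using r log_coeff_nonneg by (auto intro!: mult_nonneg_nonneg power_mono)
    show "0 < real 1 ^ j * log_coeff s t 1 * (r ^ 1 - r' ^ 1)"
      using log_coeff_ge[OF al] r by simp
  qed (use d in \<open>auto simp: sums_iff\<close>)
  then show ?thesis using d by (simp add: sums_iff)
qed

lemma moment_continuous: "continuous_on {0<..} (moment j s t)"
  unfolding continuous_on_eq_continuous_at[OF open_greaterThan]
proof
  fix y :: real assume "y \<in> {0<..}"
  then have "norm (exp (- 2 * pi * y)) < 1" by simp
  then have "isCont (power_sum (\<lambda>m. real m ^ j * log_coeff s t m)) (exp (- 2 * pi * y))"
    by (intro DERIV_isCont[OF power_sum_deriv] poly_growth_power_times poly_growth_log_coeff)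
  then have c: "isCont (\<lambda>y. power_sum (\<lambda>m. real m ^ j * log_coeff s t m) (exp (- 2 * pi * y))) y"
    by (rule isCont_o2[where f = "\<lambda>y. exp (- 2 * pi * y)", rotated]) (intro continuous_intros)
  show "isCont (moment j s t) y" unfolding moment_def[abs_def]
    by (rule c)
qed

text \<open>The first moment is continuous and strictly decreasing. It exceeds \<open>N\<close> at a small \<open>y\<close> because of the
  single term \<open>m = s * t * N + 1\<close>, an allowed integer, at \<open>y = 1 / (2 * \<pi> * m)\<close>; at \<open>y = 2\<close> it is at most \<open>1\<close>.\<close>

lemma ex1_saddle_point:
  assumes "N > 0" "s > 1" "t > 1"
  shows "\<exists>!y. y > 0 \<and> moment 1 s t y = real N"
proof -
  define m where "m = s * t * N + 1"
  define y0 where "y0 = 1 / (2 * pi * real m)"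
  have m: "m > 0" by (simp add: m_def)
  have y0: "0 < y0" using m by (simp add: y0_def)
  have "1 * 1 \<le> (2 * pi) * real m"
    using pi_gt3 m by (intro mult_mono) auto
  then have y02: "y0 \<le> 2" unfolding y0_def by (intro divide_le_eq[THEN iffD2]) simp
  have al: "allowed s t m"
  proof -
    have "d dvd m \<longleftrightarrow> d dvd 1" if "d dvd s * t * N" for d
      using that unfolding m_def by (rule dvd_add_right_iff)
    from this[of s] this[of t] show ?thesis using assms by (simp add: allowed_def)
  qed
  have "real N \<le> real m * 2 * exp (- 1)"
  proof -
    have "exp (1::real) \<le> 3" by (rule exp_le)
    then have "exp (- 1 :: real) \<ge> 1 / 3" by (simp add: exp_minus field_simps)
    moreover have "2 * 1 * N \<le> s * t * N" using assms by (intro mult_le_mono) auto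
    then have "2 * N \<le> m" unfolding m_def by linarith
    then have "2 * real N \<le> real m" by linarith
    ultimately have "2 * real N * (1 / 3) \<le> real m * exp (- 1)" by (intro mult_mono) auto
    then show ?thesis by simp
  qed
  also have "\<dots> \<le> real m ^ 1 * log_coeff s t m * exp (- 2 * pi * y0) ^ m"
  proof -
    have "exp (- 2 * pi * y0) ^ m = exp (- 1 :: real)"
      using m by (simp add: y0_def exp_of_nat_mult[symmetric])
    then show ?thesis using log_coeff_ge[OF al]
      by (simp only: power_one_right) (intro mult_right_mono mult_left_mono, auto)
  qed
  also have "\<dots> \<le> moment 1 s t y0" by (rule moment_ge_term[OF y0])
  finally have hi: "real N \<le> moment 1 s t y0" .
  have "moment 1 s t 2 \<le> 4 * fact 1 / (pi * 2) ^ Suc 1" by (rule moment_le) simp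
  also have "\<dots> \<le> 1"
  proof -
    have "1 * 1 \<le> pi * pi" using pi_gt3 by (intro mult_mono) auto
    then have "4 \<le> (pi * 2) ^ Suc 1" by (simp add: power2_eq_square)
    then show ?thesis by (intro divide_le_eq_1[THEN iffD2]) simp
  qed
  also have "1 \<le> real N" using assms by simp
  finally have lo: "moment 1 s t 2 \<le> real N" .
  have "\<exists>y\<ge>y0. y \<le> 2 \<and> moment 1 s t y = real N"
  proof (rule IVT2'[OF lo hi y02])
    show "continuous_on {y0..2} (moment 1 s t)"
      using y0 by (intro continuous_on_subset[OF moment_continuous]) auto
  qed
  then obtain y where "y0 \<le> y" "moment 1 s t y = real N" by blast
  with y0 have y: "y > 0" "moment 1 s t y = real N" by simp_all
  show ?thesis
  proof (rule ex1I)
    show "y > 0 \<and> moment 1 s t y = real N" by (rule conjI) (rule y)+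
    fix y' assume y': "y' > 0 \<and> moment 1 s t y' = real N"
    show "y' = y"
    proof (cases y y' rule: linorder_cases)
      case less
      then show ?thesis using moment_strict_decreasing[of y y' s t 1] y y' assms by simp
    next
      case greater
      then show ?thesis using moment_strict_decreasing[of y' y s t 1] y y' assms by simp
    next
      case equal
      then show ?thesis by (rule sym)
    qed
  qed
qed

section \<open>Laplace approximation\<close>

lemma exp_neg_inverse_le:
  assumes "c > 0" "y > 0" shows "exp (- (c / y)) \<le> fact k / c ^ k * (y::real) ^ k"
proof -
  have "(c / y) ^ k / fact k \<le> exp (c / y)" using assms by (intro power_div_fact_le_exp) auto
  then have "c ^ k \<le> exp (c / y) * (fact k * y ^ k)"
    using assms by (simp add: field_simps power_divide)
  then show ?thesis using assms by (simp add: exp_minus field_simps)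
qed

text \<open>Write \<open>\<psi> = - \<theta>\<^sup>2 * S2 / 2 + w\<close>. The leading part of \<open>w\<close> is the cubic term, which is purely imaginary and so
  drops out of the real part at first order; what remains is \<open>(cmod w)\<^sup>2\<close> and the quartic remainder. In the
  scaled variable \<open>v = \<theta>\<^sup>2 / y ^ 3\<close> these are of size \<open>v ^ 3 * y\<close> and \<open>v\<^sup>2 * y\<close>: one factor \<open>y\<close> smaller than
  the main term. The condition on \<open>\<delta>\<close> keeps the quartic remainder below half of the Gaussian exponent.\<close>

lemma gaussian_approximation_near_saddle:
  fixes y \<theta> :: real and \<psi> :: complex
  assumes y: "y > 0" and c: "c > 0" "c / y ^ 3 \<le> S2"
    and S3: "\<bar>S3\<bar> \<le> K3 / y ^ 4" and S4: "0 \<le> S4" "S4 \<le> K4 / y ^ 5"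
    and \<psi>: "norm (\<psi> + of_real (\<theta>\<^sup>2 * S2 / 2) + \<i> * of_real (\<theta> ^ 3 * S3 / 6)) \<le> \<theta> ^ 4 * S4 / 24"
    and \<delta>: "\<delta> > 0" "\<delta>\<^sup>2 * K4 \<le> 6 * c" "\<bar>\<theta>\<bar> \<le> \<delta> * y"
  defines "M \<equiv> K3 / 6 + \<delta> * K4 / 24" and "v \<equiv> \<theta>\<^sup>2 / y ^ 3"
  shows "\<bar>Re (exp \<psi>) - exp (- (\<theta>\<^sup>2 * S2 / 2))\<bar>
    \<le> (M\<^sup>2 * (fact 3 / (c / 8) ^ 3) + K4 / 24 * (fact 2 / (c / 8) ^ 2)) * y * exp (- (c / 8) * v)"
proof -
  define w where "w = \<psi> + of_real (\<theta>\<^sup>2 * S2 / 2)"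
  define R where "R = w + \<i> * of_real (\<theta> ^ 3 * S3 / 6)"
  have v: "v \<ge> 0" using y by (simp add: v_def)
  have K3: "K3 \<ge> 0" using S3 y by (meson abs_ge_zero order.trans zero_le_divide_iff zero_less_power not_less)
  have K4: "K4 \<ge> 0" using S4 y by (meson order.trans zero_le_divide_iff zero_less_power not_less)
  have M: "M \<ge> 0" using K3 K4 \<delta> by (simp add: M_def)
  have vS: "c * v \<le> \<theta>\<^sup>2 * S2"
    using mult_left_mono[OF c(2), of "\<theta>\<^sup>2"] by (simp add: v_def mult_ac)
  have \<theta>2: "\<theta>\<^sup>2 \<le> \<delta>\<^sup>2 * y\<^sup>2"
    using \<delta> y by (metis power_mult_distrib abs_le_square_iff abs_of_pos mult_pos_pos)
  have y5: "y ^ 5 = y ^ 3 * y\<^sup>2" by (simp add: eval_nat_numeral)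
  have \<theta>4: "\<theta> ^ 4 * S4 / 24 \<le> K4 / 24 * (v\<^sup>2 * y)"
  proof -
    have "\<theta> ^ 4 * S4 \<le> \<theta> ^ 4 * (K4 / y ^ 5)" using S4 by (intro mult_left_mono) auto
    also have "\<theta> ^ 4 * (K4 / y ^ 5) = K4 * (\<theta> ^ 4 / y ^ 5)" by simp
    also have "\<theta> ^ 4 / y ^ 5 = v\<^sup>2 * y" using y by (simp add: v_def field_simps eval_nat_numeral)
    finally show ?thesis by simp
  qed
  have nR: "norm R \<le> K4 / 24 * (v\<^sup>2 * y)"
    using \<psi> \<theta>4 by (simp add: R_def w_def)
  have "K4 * (v\<^sup>2 * y) \<le> 6 * (\<theta>\<^sup>2 * S2)"
  proof -
    have "v\<^sup>2 * y = v * (\<theta>\<^sup>2 / y\<^sup>2)" using y by (simp add: v_def field_simps eval_nat_numeral)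
    also have "\<dots> \<le> v * \<delta>\<^sup>2" using \<theta>2 y v by (intro mult_left_mono) (auto simp: field_simps)
    finally have "K4 * (v\<^sup>2 * y) \<le> K4 * (v * \<delta>\<^sup>2)" using K4 by (intro mult_left_mono)
    also have "\<dots> = (\<delta>\<^sup>2 * K4) * v" by simp
    also have "\<dots> \<le> (6 * c) * v" using \<delta> v by (intro mult_right_mono)
    finally show ?thesis using vS by simp
  qed
  then have nR4: "norm R \<le> \<theta>\<^sup>2 * S2 / 4" using nR by simp
  have Re: "Re w = Re R" by (simp add: R_def)
  have nw: "(norm w)\<^sup>2 \<le> M\<^sup>2 * (v ^ 3 * y)"
  proof -
    have "norm w \<le> norm R + norm (\<i> * of_real (\<theta> ^ 3 * S3 / 6))"
      unfolding R_def by (metis add_diff_cancel_right' norm_triangle_ineq4)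
    also have "norm (\<i> * of_real (\<theta> ^ 3 * S3 / 6)) = \<bar>\<theta>\<bar> ^ 3 * \<bar>S3\<bar> / 6"
      by (simp only: norm_mult norm_of_real norm_ii) (simp add: abs_mult power_abs)
    also have "\<dots> \<le> \<bar>\<theta>\<bar> ^ 3 * (K3 / y ^ 4) / 6" using S3 by (intro divide_right_mono mult_left_mono) auto
    also have "norm R \<le> \<delta> * K4 / 24 * (\<bar>\<theta>\<bar> ^ 3 / y ^ 4)"
    proof -
      have "v\<^sup>2 * y = \<bar>\<theta>\<bar> * \<bar>\<theta>\<bar> ^ 3 / y ^ 5"
        using y by (simp add: v_def power_abs[symmetric] field_simps eval_nat_numeral abs_mult_self_eq)
      also have "\<dots> \<le> (\<delta> * y) * \<bar>\<theta>\<bar> ^ 3 / y ^ 5"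
        using \<delta> y by (intro divide_right_mono mult_right_mono) auto
      also have "\<dots> = \<delta> * (\<bar>\<theta>\<bar> ^ 3 / y ^ 4)" using y by (simp add: field_simps eval_nat_numeral)
      finally have "K4 / 24 * (v\<^sup>2 * y) \<le> K4 / 24 * (\<delta> * (\<bar>\<theta>\<bar> ^ 3 / y ^ 4))"
        using K4 by (intro mult_left_mono) auto
      then show ?thesis using nR by (simp add: mult_ac)
    qed
    finally have "norm w \<le> M * (\<bar>\<theta>\<bar> ^ 3 / y ^ 4)" by (simp add: M_def algebra_simps)
    then have "(norm w)\<^sup>2 \<le> (M * (\<bar>\<theta>\<bar> ^ 3 / y ^ 4))\<^sup>2" by (intro power_mono) auto
    also have "\<dots> = M\<^sup>2 * (v ^ 3 * y)"
    proof -
      have "(\<bar>\<theta>\<bar> ^ 3 / y ^ 4)\<^sup>2 = (\<bar>\<theta>\<bar>\<^sup>2) ^ 3 / y ^ 8" by (simp add: power_divide flip: power_mult)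
      also have "\<dots> = v ^ 3 * y" using y by (simp add: v_def field_simps eval_nat_numeral)
      finally have e: "(\<bar>\<theta>\<bar> ^ 3 / y ^ 4)\<^sup>2 = v ^ 3 * y" .
      show ?thesis by (simp only: power_mult_distrib[of M "\<bar>\<theta>\<bar> ^ 3 / y ^ 4"] e)
    qed
    finally show ?thesis .
  qed
  \<comment> \<open>the real part of \<open>w\<close> is that of the remainder alone, so the exponential costs at most half of the Gaussian\<close>
  have taylor: "norm (exp w - 1 - w) \<le> exp (\<theta>\<^sup>2 * S2 / 4) * (norm w)\<^sup>2"
  proof -
    have "norm (exp w - (\<Sum>k\<le>1. w ^ k / fact k)) \<le> exp \<bar>Re w\<bar> * norm w ^ Suc 1 / fact 1" by (rule Taylor_exp)
    then have "norm (exp w - 1 - w) \<le> exp \<bar>Re w\<bar> * (norm w)\<^sup>2" by (simp add: power2_eq_square diff_diff_eq)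
    moreover have "\<bar>Re w\<bar> \<le> \<theta>\<^sup>2 * S2 / 4" using nR4 abs_Re_le_cmod[of R] Re by simp
    ultimately show ?thesis by (meson exp_le_cancel_iff mult_right_mono order.trans zero_le_power2)
  qed
  have "exp \<psi> = of_real (exp (- (\<theta>\<^sup>2 * S2 / 2))) * exp w"
    unfolding exp_of_real[symmetric] exp_add[symmetric] by (simp add: w_def)
  then have "Re (exp \<psi>) = exp (- (\<theta>\<^sup>2 * S2 / 2)) * Re (exp w)" by simp
  then have "Re (exp \<psi>) - exp (- (\<theta>\<^sup>2 * S2 / 2)) = exp (- (\<theta>\<^sup>2 * S2 / 2)) * (Re (exp w - 1 - w) + Re R)"
    by (simp add: Re algebra_simps)
  then have "\<bar>Re (exp \<psi>) - exp (- (\<theta>\<^sup>2 * S2 / 2))\<bar> = exp (- (\<theta>\<^sup>2 * S2 / 2)) * \<bar>Re (exp w - 1 - w) + Re R\<bar>"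
    by (simp add: abs_mult)
  also have "\<dots> \<le> exp (- (\<theta>\<^sup>2 * S2 / 2)) * (exp (\<theta>\<^sup>2 * S2 / 4) * (norm w)\<^sup>2 + exp (\<theta>\<^sup>2 * S2 / 4) * norm R)"
  proof (rule mult_left_mono)
    have "0 \<le> \<theta>\<^sup>2 * S2" using vS v c by (meson mult_nonneg_nonneg order.trans less_imp_le)
    then have "1 * norm R \<le> exp (\<theta>\<^sup>2 * S2 / 4) * norm R" by (intro mult_right_mono) auto
    then show "\<bar>Re (exp w - 1 - w) + Re R\<bar> \<le> exp (\<theta>\<^sup>2 * S2 / 4) * (norm w)\<^sup>2 + exp (\<theta>\<^sup>2 * S2 / 4) * norm R"
      using taylor abs_Re_le_cmod[of "exp w - 1 - w"] abs_Re_le_cmod[of R] by linarith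
  qed simp
  also have "\<dots> = exp (- (\<theta>\<^sup>2 * S2 / 4)) * ((norm w)\<^sup>2 + norm R)"
    unfolding distrib_left[symmetric] mult.assoc[symmetric] exp_add[symmetric] by simp
  also have "\<dots> \<le> exp (- (c * v / 4)) * (M\<^sup>2 * (v ^ 3 * y) + K4 / 24 * (v\<^sup>2 * y))"
    using vS nw nR by (intro mult_mono add_mono) auto
  also have "\<dots> = y * (M\<^sup>2 * (v ^ 3 * exp (- 2 * (c / 8) * v)) + K4 / 24 * (v\<^sup>2 * exp (- 2 * (c / 8) * v)))"
    by (simp add: algebra_simps)
  also have "\<dots> \<le> y * (M\<^sup>2 * (fact 3 / (c / 8) ^ 3 * exp (- (c / 8) * v)) + K4 / 24 * (fact 2 / (c / 8) ^ 2 * exp (- (c / 8) * v)))"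
    using v c y K4 by (intro mult_left_mono add_mono power_times_exp_le) auto
  also have "\<dots> = (M\<^sup>2 * (fact 3 / (c / 8) ^ 3) + K4 / 24 * (fact 2 / (c / 8) ^ 2)) * y * exp (- (c / 8) * v)"
    by (simp only: distrib_left distrib_right mult_ac)
  finally show ?thesis .
qed

text \<open>The normal density with variance \<open>1 / (2 * a)\<close> has total mass \<open>1\<close>.\<close>

lemma gaussian_integral:
  fixes a :: real assumes "a > 0"
  shows "integrable lborel (\<lambda>x. exp (- a * x\<^sup>2))" "(\<integral>x. exp (- a * x\<^sup>2) \<partial>lborel) = sqrt (pi / a)"
proof -
  define \<sigma> where "\<sigma> = sqrt (1 / (2 * a))"
  have \<sigma>: "\<sigma>\<^sup>2 = 1 / (2 * a)" using assms by (simp add: \<sigma>_def)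
  have eq: "exp (- a * x\<^sup>2) = sqrt (pi / a) * normal_density 0 \<sigma> x" for x
    using assms by (simp add: normal_density_def \<sigma> real_sqrt_divide)
  have sp: "\<sigma> > 0" using assms by (simp add: \<sigma>_def)
  show "integrable lborel (\<lambda>x. exp (- a * x\<^sup>2))"
    unfolding eq by (intro integrable_mult_right integrable_normal_density sp)
  have i: "(\<integral>x. normal_density 0 \<sigma> x \<partial>lborel) = 1" using sp by (rule integral_normal_density)
  show "(\<integral>x. exp (- a * x\<^sup>2) \<partial>lborel) = sqrt (pi / a)"
    unfolding eq integral_mult_right_zero i by simp
qed

text \<open>The Gaussian is compared with \<open>f\<close> inside the interval, and with \<open>0\<close> outside it.\<close>

lemma laplace_integral_bound:
  fixes f :: "real \<Rightarrow> real"
  assumes f: "continuous_on {-pi..pi} f" and S: "S > 0" and B: "B \<ge> 0" "a > 0" "D \<ge> 0"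
    and inside: "\<And>\<theta>. \<bar>\<theta>\<bar> \<le> pi \<Longrightarrow> \<bar>f \<theta> - exp (- (\<theta>\<^sup>2 * S / 2))\<bar> \<le> B * exp (- a * \<theta>\<^sup>2) + D"
    and outside: "\<And>\<theta>. \<bar>\<theta>\<bar> > pi \<Longrightarrow> exp (- (\<theta>\<^sup>2 * S / 2)) \<le> B * exp (- a * \<theta>\<^sup>2)"
  shows "\<bar>(\<integral>\<theta>. indicator {-pi..pi} \<theta> *\<^sub>R f \<theta> \<partial>lborel) - sqrt (2 * pi / S)\<bar> \<le> B * sqrt (pi / a) + 2 * pi * D"
proof -
  have intf: "integrable lborel (\<lambda>\<theta>. indicator {-pi..pi} \<theta> *\<^sub>R f \<theta>)"
    using borel_integrable_atLeastAtMost'[OF f] by (simp add: set_integrable_def)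
  have intg: "integrable lborel (\<lambda>\<theta>. exp (- (S / 2) * \<theta>\<^sup>2))"
    and g: "(\<integral>\<theta>. exp (- (S / 2) * \<theta>\<^sup>2) \<partial>lborel) = sqrt (2 * pi / S)"
    using gaussian_integral[of "S / 2"] S by (simp_all add: mult.commute)
  have intI: "integrable lborel (indicator {-pi..pi} :: real \<Rightarrow> real)" by simp
  have intb: "integrable lborel (\<lambda>\<theta>. B * exp (- a * \<theta>\<^sup>2) + D * indicator {-pi..pi} \<theta>)"
    using gaussian_integral(1)[OF B(2)] by (intro Bochner_Integration.integrable_add integrable_mult_right intI)
  have "norm (\<integral>\<theta>. indicator {-pi..pi} \<theta> *\<^sub>R f \<theta> - exp (- (S / 2) * \<theta>\<^sup>2) \<partial>lborel)
     \<le> (\<integral>\<theta>. B * exp (- a * \<theta>\<^sup>2) + D * indicator {-pi..pi} \<theta> \<partial>lborel)"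
  proof (rule Bochner_Integration.integral_norm_bound_integral[OF Bochner_Integration.integrable_diff[OF intf intg] intb])
    fix \<theta> :: real
    have e: "exp (- (S / 2) * \<theta>\<^sup>2) = exp (- (\<theta>\<^sup>2 * S / 2))" by (simp add: mult.commute)
    show "norm (indicator {-pi..pi} \<theta> *\<^sub>R f \<theta> - exp (- (S / 2) * \<theta>\<^sup>2)) \<le> B * exp (- a * \<theta>\<^sup>2) + D * indicator {-pi..pi} \<theta>"
    proof (cases "\<bar>\<theta>\<bar> \<le> pi")
      case True
      then have "\<theta> \<in> {-pi..pi}" by auto
      then show ?thesis unfolding e using inside[OF True] by simp
    next
      case False
      then have "\<theta> \<notin> {-pi..pi}" by auto
      then show ?thesis unfolding e using outside[of \<theta>] False by simp
    qed
  qed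
  also have "(\<integral>\<theta>. B * exp (- a * \<theta>\<^sup>2) + D * indicator {-pi..pi} \<theta> \<partial>lborel) = B * sqrt (pi / a) + 2 * pi * D"
    using gaussian_integral[OF B(2)] intI
    by (subst Bochner_Integration.integral_add) (auto intro!: integrable_mult_right)
  finally show ?thesis
    unfolding Bochner_Integration.integral_diff[OF intf intg] g by simp
qed

lemma laplace_far_bound:
  assumes "c > 0" "y > 0" "c / y \<le> x" shows "exp (- x) \<le> fact 3 / c ^ 3 * (y::real) ^ 3"
proof -
  have "exp (- x) \<le> exp (- (c / y))" using assms by simp
  also have "\<dots> \<le> fact 3 / c ^ 3 * y ^ 3" using assms by (intro exp_neg_inverse_le)
  finally show ?thesis .
qed

section \<open>The coefficient integral\<close>

text \<open>The exponent in Cauchy's integral for the coefficient, normalised to vanish at \<open>\<theta> = 0\<close>. The linear term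
  is subtracted with the first moment in place of \<open>N\<close>; at the saddle point the two agree.\<close>

definition saddle_phase :: "nat \<Rightarrow> nat \<Rightarrow> real \<Rightarrow> real \<Rightarrow> complex" where
  "saddle_phase s t y \<theta> = power_sum (log_coeff s t) (exp (- 2 * pi * y) * exp (\<i> * \<theta>))
     - of_real (moment 0 s t y) - \<i> * of_real (\<theta> * moment 1 s t y)"

lemma norm_circle_point:
  "y > 0 \<Longrightarrow> norm (exp (- 2 * pi * y) * exp (\<i> * of_real \<theta>)) < 1"
  by (simp add: norm_mult)

lemma circle_point_power:
  "(complex_of_real r * exp (\<i> * of_real \<theta>)) ^ m = of_real (r ^ m) * iexp (real m * \<theta>)"
  by (simp add: power_mult_distrib exp_of_nat_mult[symmetric] mult_ac)

lemma log_generating_function_sums: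
  assumes "y > 0"
  shows "(\<lambda>m. of_real (log_coeff s t m * exp (- 2 * pi * y) ^ m) * iexp (real m * \<theta>)) sums
     power_sum (log_coeff s t) (exp (- 2 * pi * y) * exp (\<i> * \<theta>))"
proof -
  have "(\<lambda>m. of_real (log_coeff s t m) * (exp (- 2 * pi * y) * exp (\<i> * of_real \<theta>)) ^ m) sums
     power_sum (log_coeff s t) (exp (- 2 * pi * y) * exp (\<i> * \<theta>))"
    unfolding power_sum_def
    by (intro summable_sums summable_power_sum'[OF poly_growth_log_coeff norm_circle_point] assms)
  then show ?thesis unfolding circle_point_power by (simp add: mult.assoc)
qed

lemma saddle_phase_sums:
  assumes "y > 0"
  shows "(\<lambda>m. of_real (log_coeff s t m * exp (- 2 * pi * y) ^ m) * (iexp (real m * \<theta>) - 1 - \<i> * of_real (real m * \<theta>)))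
     sums saddle_phase s t y \<theta>"
proof -
  define f where "f = (\<lambda>m. log_coeff s t m * exp (- 2 * pi * y) ^ m)"
  have 0: "f sums moment 0 s t y" using moment_sums[OF assms, of 0 s t] by (simp add: f_def)
  have 1: "(\<lambda>m. real m * f m) sums moment 1 s t y" using moment_sums[OF assms, of 1 s t] by (simp add: f_def mult.assoc)
  have L: "(\<lambda>m. of_real (f m) * iexp (real m * \<theta>)) sums
     power_sum (log_coeff s t) (exp (- 2 * pi * y) * exp (\<i> * \<theta>))"
    unfolding f_def by (rule log_generating_function_sums[OF assms])
  have "(\<lambda>m. of_real (f m) * iexp (real m * \<theta>) - of_real (f m) - \<i> * of_real (\<theta> * (real m * f m))) sums
     saddle_phase s t y \<theta>"
    unfolding saddle_phase_def
    by (intro sums_diff sums_mult sums_of_real L 0 1)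
  moreover have "(\<lambda>m. of_real (f m) * iexp (real m * \<theta>) - of_real (f m) - \<i> * of_real (\<theta> * (real m * f m)))
     = (\<lambda>m. of_real (f m) * (iexp (real m * \<theta>) - 1 - \<i> * of_real (real m * \<theta>)))"
    by (simp add: algebra_simps)
  ultimately show ?thesis by (simp add: f_def)
qed

lemma Re_saddle_phase:
  assumes "y > 0" shows "Re (saddle_phase s t y \<theta>) = - cosine_deficit s t y \<theta>"
proof -
  have "(\<lambda>m. - (log_coeff s t m * exp (- 2 * pi * y) ^ m * (1 - cos (real m * \<theta>)))) sums Re (saddle_phase s t y \<theta>)"
    using sums_Re[OF saddle_phase_sums[OF assms, of s t \<theta>]] by (simp add: Re_exp algebra_simps)
  moreover have "(\<lambda>m. - (log_coeff s t m * exp (- 2 * pi * y) ^ m * (1 - cos (real m * \<theta>)))) sums - cosine_deficit s t y \<theta>"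
    unfolding cosine_deficit_def by (intro sums_minus summable_sums log_coeff_cosine_summable assms)
  ultimately show ?thesis by (rule sums_unique2)
qed

text \<open>The third-order Taylor estimate of \<open>exp (\<i> m \<theta>)\<close> is applied to each term; the moments arise as the sums of
  the coefficients, which are nonnegative.\<close>

lemma saddle_phase_taylor:
  assumes "y > 0"
  shows "norm (saddle_phase s t y \<theta> + of_real (\<theta>\<^sup>2 * moment 2 s t y / 2) + \<i> * of_real (\<theta> ^ 3 * moment 3 s t y / 6))
     \<le> \<theta> ^ 4 * moment 4 s t y / 24"
proof -
  define f where "f = (\<lambda>m. log_coeff s t m * exp (- 2 * pi * y) ^ m)"
  have f: "f m \<ge> 0" for m using log_coeff_nonneg by (simp add: f_def)
  have mom: "(\<lambda>m. real m ^ j * f m) sums moment j s t y" for j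
    using moment_sums[OF assms, of j s t] by (simp add: f_def mult.assoc)
  define g where "g = (\<lambda>m. of_real (f m) * (iexp (real m * \<theta>) - 1 - \<i> * of_real (real m * \<theta>))
      + of_real (\<theta>\<^sup>2 * (real m ^ 2 * f m) / 2) + \<i> * of_real (\<theta> ^ 3 * (real m ^ 3 * f m) / 6))"
  have P: "(\<lambda>m. of_real (f m) * (iexp (real m * \<theta>) - 1 - \<i> * of_real (real m * \<theta>))) sums saddle_phase s t y \<theta>"
    unfolding f_def by (rule saddle_phase_sums[OF assms])
  have g: "g sums (saddle_phase s t y \<theta> + of_real (\<theta>\<^sup>2 * moment 2 s t y / 2) + \<i> * of_real (\<theta> ^ 3 * moment 3 s t y / 6))"
    unfolding g_def by (intro sums_add sums_mult sums_of_real sums_divide mom P)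
  have h: "(\<lambda>m. \<theta> ^ 4 * (real m ^ 4 * f m) / 24) sums (\<theta> ^ 4 * moment 4 s t y / 24)"
    by (intro sums_divide sums_mult mom)
  have le: "norm (g m) \<le> \<theta> ^ 4 * (real m ^ 4 * f m) / 24" for m
  proof -
    define x where "x = real m * \<theta>"
    have "g m = of_real (f m) * (iexp x - (\<Sum>k\<le>3. (\<i> * x) ^ k / fact k))"
      by (simp add: g_def x_def eval_nat_numeral algebra_simps)
    then have "norm (g m) = f m * norm (iexp x - (\<Sum>k\<le>3. (\<i> * x) ^ k / fact k))"
      using f[of m] by (simp add: norm_mult)
    also have "\<dots> \<le> f m * (\<bar>x\<bar> ^ Suc 3 / fact (Suc 3))"
      using f by (intro mult_left_mono iexp_approx1) auto
    also have "\<bar>x\<bar> ^ Suc 3 = x ^ 4" using power_even_abs[of 4 x] by simp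
    also have "fact (Suc 3) = (24 :: real)" by (simp add: fact_numeral)
    finally show ?thesis by (simp add: x_def power_mult_distrib mult_ac)
  qed
  have sn: "summable (\<lambda>m. norm (g m))"
  proof (rule summable_comparison_test'[of "\<lambda>m. \<theta> ^ 4 * (real m ^ 4 * f m) / 24" 0])
    show "summable (\<lambda>m. \<theta> ^ 4 * (real m ^ 4 * f m) / 24)" using h by (rule sums_summable)
    show "norm (norm (g m)) \<le> \<theta> ^ 4 * (real m ^ 4 * f m) / 24" for m using le by simp
  qed
  have "norm (suminf g) \<le> (\<Sum>m. norm (g m))" by (rule summable_norm[OF sn])
  also have "\<dots> \<le> (\<Sum>m. \<theta> ^ 4 * (real m ^ 4 * f m) / 24)"
    by (rule suminf_le[OF le sn sums_summable[OF h]])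
  finally show ?thesis unfolding sums_unique[OF g] sums_unique[OF h] .
qed

text \<open>Since \<open>1 - cos (m * y) \<le> (m * y)\<^sup>2 / 2\<close>, the second moment dominates \<open>2 / y\<^sup>2\<close> times the cosine deficit at
  the angle \<open>\<theta> = y\<close>, for which a lower bound of order \<open>1 / y\<close> is known.\<close>

lemma moment_2_ge:
  assumes "0 < y" "y \<le> 1 / 200" "s \<ge> 10" "t \<ge> 10"
  defines "\<kappa> \<equiv> 1 / 12 :: real"
  shows "2 * (\<kappa> / (2 * pi * (4 * pi\<^sup>2 + 2 * \<kappa>))) / y ^ 3 \<le> moment 2 s t y"
proof -
  define c where "c = \<kappa> / (2 * pi * (4 * pi\<^sup>2 + 2 * \<kappa>))"
  have "\<bar>y\<bar> \<le> pi" using assms pi_gt3 by simp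
  then have "c / y \<le> cosine_deficit s t y y"
    unfolding c_def using one_minus_cos_ge[of y] by (intro cosine_deficit_ge assms) (auto simp: \<kappa>_def)
  also have "\<dots> \<le> y\<^sup>2 / 2 * moment 2 s t y"
  proof -
    have U: "(\<lambda>m. y\<^sup>2 / 2 * (real m ^ 2 * log_coeff s t m * exp (- 2 * pi * y) ^ m)) sums (y\<^sup>2 / 2 * moment 2 s t y)"
      by (intro sums_mult moment_sums assms)
    have L: "(\<lambda>m. log_coeff s t m * exp (- 2 * pi * y) ^ m * (1 - cos (real m * y))) sums cosine_deficit s t y y"
      unfolding cosine_deficit_def by (intro summable_sums log_coeff_cosine_summable assms)
    have le: "log_coeff s t m * exp (- 2 * pi * y) ^ m * (1 - cos (real m * y))
       \<le> y\<^sup>2 / 2 * (real m ^ 2 * log_coeff s t m * exp (- 2 * pi * y) ^ m)" for m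
    proof -
      have "log_coeff s t m * exp (- 2 * pi * y) ^ m * (1 - cos (real m * y))
          \<le> log_coeff s t m * exp (- 2 * pi * y) ^ m * ((real m * y)\<^sup>2 / 2)"
        using log_coeff_nonneg by (intro mult_left_mono one_minus_cos_le) auto
      then show ?thesis by (simp add: power_mult_distrib mult_ac)
    qed
    show ?thesis by (rule sums_le[OF le L U])
  qed
  finally have "c / y * (2 * y) \<le> y\<^sup>2 / 2 * moment 2 s t y * (2 * y)"
    using assms by (intro mult_right_mono) auto
  then have "2 * c \<le> moment 2 s t y * y ^ 3"
    using assms by (simp add: power2_eq_square power3_eq_cube mult_ac)
  then show ?thesis unfolding c_def[symmetric] using assms by (intro pos_divide_le_eq[THEN iffD2]) auto
qed

definition saddle_integral :: "nat \<Rightarrow> nat \<Rightarrow> real \<Rightarrow> real" where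
  "saddle_integral s t y = (\<integral>\<theta>. indicator {-pi..pi} \<theta> *\<^sub>R Re (exp (saddle_phase s t y \<theta>)) \<partial>lborel)"

lemma continuous_saddle_phase:
  assumes "y > 0" shows "continuous_on A (saddle_phase s t y)"
proof -
  have "isCont (saddle_phase s t y) \<theta>" for \<theta>
  proof -
    have p: "isCont (power_sum (log_coeff s t)) (exp (- 2 * pi * y) * exp (\<i> * of_real \<theta>))"
      by (intro DERIV_isCont[OF power_sum_deriv] poly_growth_log_coeff norm_circle_point assms)
    have e: "isCont (\<lambda>\<theta>. complex_of_real (exp (- 2 * pi * y)) * exp (\<i> * of_real \<theta>)) \<theta>"
      by (intro continuous_intros)
    have "isCont (\<lambda>\<theta>. power_sum (log_coeff s t) (exp (- 2 * pi * y) * exp (\<i> * of_real \<theta>))) \<theta>"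
      by (rule isCont_o2[OF e p])
    then show ?thesis unfolding saddle_phase_def[abs_def] by (intro continuous_intros)
  qed
  then show ?thesis by (intro continuous_at_imp_continuous_on) auto
qed

lemma integral_cos_multiple:
  fixes k :: int
  shows "(\<integral>\<theta>. indicator {-pi..pi} \<theta> *\<^sub>R cos (of_int k * \<theta>) \<partial>lborel) = (if k = 0 then 2 * pi else 0)"
proof (cases "k = 0")
  case False
  have "(\<integral>\<theta>. indicator {-pi..pi} \<theta> *\<^sub>R cos (of_int k * \<theta>) \<partial>lborel)
     = sin (of_int k * pi) / of_int k - sin (of_int k * (- pi)) / of_int k"
    using False
    by (intro integral_FTC_atLeastAtMost[of "-pi" pi "\<lambda>\<theta>. sin (of_int k * \<theta>) / of_int k"] continuous_intros)
      (auto intro!: derivative_eq_intros simp flip: has_real_derivative_iff_has_vector_derivative)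
  moreover have "sin (of_int k * pi) = 0" by (auto simp: sin_zero_iff_int2)
  ultimately show ?thesis using False by simp
qed simp

text \<open>Cauchy's coefficient formula. Integrating the power series term by term over the circle, all terms but
  the \<open>N\<close>-th integrate to \<open>0\<close>. As the coefficients are real, taking real parts loses nothing.\<close>

lemma saddle_integral_eq:
  assumes y: "y > 0" and N: "moment 1 s t y = real N"
  shows "saddle_integral s t y = 2 * pi * real (pbar s t N) * exp (- 2 * pi * y) ^ N / exp (moment 0 s t y)"
proof -
  define r where "r = exp (- 2 * pi * y)"
  have r: "0 < r" "r < 1" using y by (auto simp: r_def)
  define E where "E = exp (moment 0 s t y)"
  define p where "p = (\<lambda>K. real (pbar s t K) * r ^ K)"
  have gf: "(\<lambda>K. of_nat (pbar s t K) * (r * exp (\<i> * of_real \<theta>)) ^ K) sums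
     exp (power_sum (log_coeff s t) (r * exp (\<i> * \<theta>)))" for \<theta> :: real
    unfolding r_def by (intro pbar_generating_function norm_circle_point y)
  have "summable (\<lambda>K. complex_of_real (p K))"
    using gf[of 0] by (simp add: sums_iff p_def)
  then have sp: "summable p" by (simp only: summable_of_real_iff)
  have pos: "p K \<ge> 0" for K using r by (simp add: p_def)
  define f where "f = (\<lambda>K \<theta>. indicator {-pi..pi} \<theta> *\<^sub>R (p K * cos (of_int (int K - int N) * \<theta>)))"
  have point: "(\<lambda>K. f K \<theta>) sums (E * (indicator {-pi..pi} \<theta> *\<^sub>R Re (exp (saddle_phase s t y \<theta>))))" for \<theta>
  proof -
    have "(\<lambda>K. of_real (p K) * iexp (real K * \<theta>)) sums exp (power_sum (log_coeff s t) (r * exp (\<i> * \<theta>)))"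
      using gf[of \<theta>] unfolding circle_point_power by (simp add: p_def mult.assoc)
    then have "(\<lambda>K. of_real (p K) * iexp (real K * \<theta>) * iexp (- (real N * \<theta>))) sums
        (exp (power_sum (log_coeff s t) (r * exp (\<i> * \<theta>))) * iexp (- (real N * \<theta>)))"
      by (intro sums_mult2)
    moreover have "exp (power_sum (log_coeff s t) (r * exp (\<i> * \<theta>))) * iexp (- (real N * \<theta>)) = E * exp (saddle_phase s t y \<theta>)"
      unfolding E_def exp_of_real[symmetric] exp_add[symmetric]
      unfolding saddle_phase_def N r_def by (simp add: algebra_simps)
    moreover have "of_real (p K) * iexp (real K * \<theta>) * iexp (- (real N * \<theta>)) = of_real (p K) * iexp (of_int (int K - int N) * \<theta>)" for K
      unfolding mult.assoc exp_add[symmetric] by (simp add: algebra_simps)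
    ultimately have "(\<lambda>K. Re (of_real (p K) * iexp (of_int (int K - int N) * \<theta>))) sums Re (E * exp (saddle_phase s t y \<theta>))"
      by (intro sums_Re) (simp only:)
    then have "(\<lambda>K. p K * cos (of_int (int K - int N) * \<theta>)) sums (E * Re (exp (saddle_phase s t y \<theta>)))"
      by (simp add: Re_exp)
    from sums_mult[OF this, of "indicator {-pi..pi} \<theta>"] show ?thesis
      unfolding f_def by (simp add: mult.left_commute)
  qed
  have intf: "integrable lborel (f K)" for K
  proof -
    have "continuous_on {-pi..pi} (\<lambda>\<theta>. p K * cos (of_int (int K - int N) * \<theta>))"
      by (intro continuous_intros)
    from borel_integrable_atLeastAtMost'[OF this] show ?thesis
      unfolding f_def set_integrable_def .
  qed
  have nf: "norm (f K \<theta>) \<le> p K * indicator {-pi..pi} \<theta>" for K \<theta>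
    using pos[of K] by (auto simp: f_def abs_mult indicator_def intro: mult_left_le)
  have "(\<lambda>K. \<integral>\<theta>. f K \<theta> \<partial>lborel) sums (\<integral>\<theta>. (\<Sum>K. f K \<theta>) \<partial>lborel)"
  proof (rule sums_integral)
    show "integrable lborel (f K)" for K by (rule intf)
    have "summable (\<lambda>K. norm (f K \<theta>))" for \<theta>
      by (rule summable_comparison_test'[of "\<lambda>K. p K * indicator {-pi..pi} \<theta>" 0]) (use nf sp in \<open>auto intro: summable_mult2\<close>)
    then show "AE \<theta> in lborel. summable (\<lambda>K. norm (f K \<theta>))" by simp
    show "summable (\<lambda>K. \<integral>\<theta>. norm (f K \<theta>) \<partial>lborel)"
    proof (rule summable_comparison_test'[of "\<lambda>K. p K * (2 * pi)" 0])
      show "summable (\<lambda>K. p K * (2 * pi))" using sp by (rule summable_mult2)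
      fix K
      have "(\<integral>\<theta>. norm (f K \<theta>) \<partial>lborel) \<le> (\<integral>\<theta>. p K * indicator {-pi..pi} \<theta> \<partial>lborel)"
        by (intro integral_mono integrable_norm intf nf) auto
      also have "\<dots> = p K * (2 * pi)" by simp
      finally show "norm (\<integral>\<theta>. norm (f K \<theta>) \<partial>lborel) \<le> p K * (2 * pi)" by simp
    qed
  qed
  moreover have "(\<integral>\<theta>. (\<Sum>K. f K \<theta>) \<partial>lborel) = E * saddle_integral s t y"
    using point unfolding saddle_integral_def by (simp add: sums_iff)
  moreover have "(\<integral>\<theta>. f K \<theta> \<partial>lborel) = (if K = N then 2 * pi * p N else 0)" for K
  proof -
    have "(\<integral>\<theta>. f K \<theta> \<partial>lborel) = p K * (\<integral>\<theta>. indicator {-pi..pi} \<theta> *\<^sub>R cos (of_int (int K - int N) * \<theta>) \<partial>lborel)"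
      unfolding f_def by (subst integral_mult_right_zero[symmetric]) (simp add: mult_ac)
    then show ?thesis unfolding integral_cos_multiple by auto
  qed
  moreover have "(\<lambda>K. if K = N then 2 * pi * p N else 0) sums (2 * pi * p N)"
    using sums_single[of N "\<lambda>_. 2 * pi * p N"] by simp
  ultimately have "E * saddle_integral s t y = 2 * pi * p N"
    by (simp add: sums_iff)
  then show ?thesis by (simp add: E_def p_def r_def field_simps)
qed

text \<open>The coefficients are nonnegative, so a single term of the generating function is at most the value
  of the generating function on the positive axis.\<close>

lemma saddle_integral_bounds:
  assumes y: "y > 0" and N: "moment 1 s t y = real N"
  shows "0 \<le> saddle_integral s t y" "saddle_integral s t y \<le> 2 * pi"
proof -
  show "0 \<le> saddle_integral s t y" unfolding saddle_integral_eq[OF assms] by simp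
  define r where "r = exp (- 2 * pi * y)"
  have r: "0 < r" "r < 1" using y by (auto simp: r_def)
  have "(\<lambda>K. of_nat (pbar s t K) * complex_of_real r ^ K) sums exp (power_sum (log_coeff s t) (complex_of_real r))"
    using r by (intro pbar_generating_function) simp
  moreover have "power_sum (log_coeff s t) (complex_of_real r) = of_real (moment 0 s t y)"
    using r by (subst power_sum_of_real) (auto simp: poly_growth_log_coeff moment_def r_def)
  ultimately have "(\<lambda>K. complex_of_real (real (pbar s t K) * r ^ K)) sums of_real (exp (moment 0 s t y))"
    by (simp add: exp_of_real)
  then have s: "(\<lambda>K. real (pbar s t K) * r ^ K) sums exp (moment 0 s t y)"
    by (simp only: sums_of_real_iff)
  have "(\<Sum>K\<in>{N}. real (pbar s t K) * r ^ K) \<le> exp (moment 0 s t y)"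
    using s r sum_le_suminf[of "\<lambda>K. real (pbar s t K) * r ^ K" "{N}"] by (simp add: sums_iff)
  then show "saddle_integral s t y \<le> 2 * pi"
    unfolding saddle_integral_eq[OF assms] by (simp add: r_def field_simps)
qed

section \<open>Asymptotics with an absolute constant\<close>

text \<open>For \<open>\<bar>\<theta>\<bar> \<le> \<delta> * y\<close> the Gaussian approximation applies. For larger \<open>\<theta>\<close> both the integrand and the Gaussian are
  at most \<open>exp (- const / y)\<close>, which is smaller than any power of \<open>y\<close>. All constants depend only on the
  bounds for the moments, not on \<open>s\<close> and \<open>t\<close>.\<close>

lemma saddle_integral_asymptotics:
  "\<exists>C>0. \<forall>y s t. 0 < y \<longrightarrow> y \<le> 1 / 200 \<longrightarrow> s \<ge> 10 \<longrightarrow> t \<ge> 10 \<longrightarrow>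
     \<bar>saddle_integral s t y - sqrt (2 * pi / moment 2 s t y)\<bar> \<le> C * (y * sqrt (y ^ 3))"
proof -
  define c :: real where "c = 2 * (1 / 12 / (2 * pi * (4 * pi\<^sup>2 + 2 * (1 / 12))))"
  define K3 K4 :: real where "K3 = 24 / pi ^ 4" and "K4 = 96 / pi ^ 5"
  \<comment> \<open>the largest \<open>\<delta>\<close> admitted by the approximation near the saddle point\<close>
  define \<delta> where "\<delta> = sqrt (6 * c / K4)"
  define \<kappa> where "\<kappa> = \<delta>\<^sup>2 / 12"
  define c' where "c' = \<kappa> / (2 * pi * (4 * pi\<^sup>2 + 2 * \<kappa>))"
  define C1 where "C1 = (K3 / 6 + \<delta> * K4 / 24)\<^sup>2 * (fact 3 / (c / 8) ^ 3) + K4 / 24 * (fact 2 / (c / 8) ^ 2)"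
  define C2 where "C2 = C1 + 8 / (3 * c)"
  define D where "D = fact 3 / c' ^ 3 + fact 3 / (\<delta>\<^sup>2 * c / 2) ^ 3"
  have c: "c > 0" by (simp add: c_def add_pos_pos)
  have K: "K3 > 0" "K4 > 0" by (simp_all add: K3_def K4_def)
  have \<delta>: "\<delta> > 0" using c K by (simp add: \<delta>_def)
  have \<delta>2: "\<delta>\<^sup>2 * K4 = 6 * c" using c K by (simp add: \<delta>_def)
  have \<kappa>: "\<kappa> > 0" using \<delta> by (simp add: \<kappa>_def)
  have c': "c' > 0" using \<kappa> by (simp add: c'_def add_pos_pos)
  have "K3 / 6 + \<delta> * K4 / 24 > 0" using K \<delta> by (intro add_pos_pos) auto
  then have C1: "C1 > 0" unfolding C1_def using c K by (intro add_pos_pos mult_pos_pos) auto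
  have C2: "C2 > 0" using C1 c by (simp add: C2_def add_pos_pos)
  have D: "D > 0" unfolding D_def using c' c \<delta> by (intro add_pos_pos divide_pos_pos) auto
  show ?thesis
  proof (intro exI[of _ "C2 * sqrt (8 * pi / c) + 2 * pi * D"] conjI allI impI)
    show "0 < C2 * sqrt (8 * pi / c) + 2 * pi * D" using C2 D c by (intro add_pos_pos mult_pos_pos) auto
    fix y :: real and s t :: nat
    assume y: "0 < y" "y \<le> 1 / 200" and st: "s \<ge> 10" "t \<ge> 10"
    define S2 where "S2 = moment 2 s t y"
    have S2: "c / y ^ 3 \<le> S2"
      unfolding S2_def c_def by (rule moment_2_ge[OF y st])
    have S2pos: "S2 > 0" using S2 c y by (meson divide_pos_pos less_le_trans zero_less_power)
    have nonneg: "moment j s t y \<ge> 0" for j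
      using moment_pos[of y s t j] y st by simp
    have S3: "\<bar>moment 3 s t y\<bar> \<le> K3 / y ^ 4"
    proof -
      have "moment 3 s t y \<le> 4 * fact 3 / (pi * y) ^ Suc 3" by (rule moment_le[OF y(1)])
      also have "\<dots> = K3 / y ^ 4" by (simp add: K3_def fact_numeral power_mult_distrib)
      finally show ?thesis using nonneg by simp
    qed
    have S4: "moment 4 s t y \<le> K4 / y ^ 5"
    proof -
      have "moment 4 s t y \<le> 4 * fact 4 / (pi * y) ^ Suc 4" by (rule moment_le[OF y(1)])
      also have "\<dots> = K4 / y ^ 5" by (simp add: K4_def fact_numeral power_mult_distrib)
      finally show ?thesis .
    qed
    define a where "a = c / 8 / y ^ 3"
    have a: "a > 0" using c y by (simp add: a_def)
    have inside: "\<bar>Re (exp (saddle_phase s t y \<theta>)) - exp (- (\<theta>\<^sup>2 * S2 / 2))\<bar>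
        \<le> C2 * y * exp (- a * \<theta>\<^sup>2) + D * y ^ 3" if \<theta>: "\<bar>\<theta>\<bar> \<le> pi" for \<theta>
    proof (cases "\<bar>\<theta>\<bar> \<le> \<delta> * y")
      case True
      have "\<bar>Re (exp (saddle_phase s t y \<theta>)) - exp (- (\<theta>\<^sup>2 * S2 / 2))\<bar>
          \<le> C1 * y * exp (- (c / 8) * (\<theta>\<^sup>2 / y ^ 3))"
        unfolding C1_def
        using gaussian_approximation_near_saddle[OF y(1) c S2 S3 nonneg S4 _ \<delta> _ True, of "saddle_phase s t y \<theta>"]
          saddle_phase_taylor[OF y(1), of s t \<theta>] \<delta>2 by (simp add: S2_def)
      also have "\<dots> = C1 * (y * exp (- a * \<theta>\<^sup>2))" by (simp add: a_def)
      also have "\<dots> \<le> C2 * (y * exp (- a * \<theta>\<^sup>2))"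
        using c y by (intro mult_right_mono) (auto simp: C2_def)
      also have "\<dots> \<le> C2 * y * exp (- a * \<theta>\<^sup>2) + D * y ^ 3" using D y by simp
      finally show ?thesis .
    next
      case False
      then have "(\<delta> * y)\<^sup>2 \<le> \<theta>\<^sup>2" using \<delta> y by (intro power2_le_iff_abs_le[THEN iffD2] abs_le_square_iff[THEN iffD1]) auto
      then have \<theta>2: "\<delta>\<^sup>2 * y\<^sup>2 \<le> \<theta>\<^sup>2" by (simp add: power_mult_distrib)
      have "\<kappa> * y\<^sup>2 \<le> 1 - cos \<theta>"
        using one_minus_cos_ge[OF \<theta>] \<theta>2 by (simp add: \<kappa>_def)
      then have "c' / y \<le> cosine_deficit s t y \<theta>"
        unfolding c'_def by (intro cosine_deficit_ge y st \<kappa>)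
      then have 1: "exp (Re (saddle_phase s t y \<theta>)) \<le> fact 3 / c' ^ 3 * y ^ 3"
        unfolding Re_saddle_phase[OF y(1)] by (rule laplace_far_bound[OF c' y(1)])
      have "\<delta>\<^sup>2 * c / 2 / y = \<delta>\<^sup>2 * y\<^sup>2 * (c / y ^ 3) / 2" using y by (simp add: field_simps eval_nat_numeral)
      also have "\<dots> \<le> \<theta>\<^sup>2 * S2 / 2" using \<theta>2 S2 c y by (intro divide_right_mono mult_mono) auto
      finally have 2: "exp (- (\<theta>\<^sup>2 * S2 / 2)) \<le> fact 3 / (\<delta>\<^sup>2 * c / 2) ^ 3 * y ^ 3"
        using c \<delta> y by (intro laplace_far_bound) auto
      have "\<bar>Re (exp (saddle_phase s t y \<theta>))\<bar> \<le> exp (Re (saddle_phase s t y \<theta>))"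
        using abs_Re_le_cmod[of "exp (saddle_phase s t y \<theta>)"] by simp
      then have "\<bar>Re (exp (saddle_phase s t y \<theta>)) - exp (- (\<theta>\<^sup>2 * S2 / 2))\<bar> \<le> D * y ^ 3"
        using 1 2 exp_gt_zero[of "- (\<theta>\<^sup>2 * S2 / 2)"] unfolding D_def distrib_right by linarith
      moreover have "0 \<le> C2 * y * exp (- a * \<theta>\<^sup>2)" using C2 y by simp
      ultimately show ?thesis by linarith
    qed
    \<comment> \<open>of the decay \<open>c / 2\<close>, the part \<open>c / 8\<close> is kept and \<open>3 * c / 8\<close> pays for the factor \<open>y\<close>, using \<open>\<theta>\<^sup>2 \<ge> 1\<close>\<close>
    have outside: "exp (- (\<theta>\<^sup>2 * S2 / 2)) \<le> C2 * y * exp (- a * \<theta>\<^sup>2)" if \<theta>: "\<bar>\<theta>\<bar> > pi" for \<theta>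
    proof -
      have "1\<^sup>2 \<le> \<theta>\<^sup>2" using \<theta> pi_gt3 by (intro abs_le_square_iff[THEN iffD1]) auto
      then have \<theta>1: "1 \<le> \<theta>\<^sup>2" by simp
      have "y ^ 3 \<le> y ^ 1" using y by (intro power_decreasing) auto
      then have "1 / y \<le> 1 / y ^ 3" using y by (intro divide_left_mono) auto
      then have "3 * c / 8 * (1 / y) \<le> 3 * c / 8 * (1 / y ^ 3)" using c by (intro mult_left_mono) auto
      also have "\<dots> \<le> 3 * c / 8 * (1 / y ^ 3) * \<theta>\<^sup>2" 
        using mult_left_mono[OF \<theta>1, of "3 * c / 8 * (1 / y ^ 3)"] c y by simp
      finally have "3 * c / 8 / y + a * \<theta>\<^sup>2 \<le> c / y ^ 3 * \<theta>\<^sup>2 / 2" by (simp add: a_def field_simps)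
      also have "\<dots> \<le> S2 * \<theta>\<^sup>2 / 2" using S2 by (intro divide_right_mono mult_right_mono) auto
      finally have "exp (- (\<theta>\<^sup>2 * S2 / 2)) \<le> exp (- (3 * c / 8 / y)) * exp (- a * \<theta>\<^sup>2)"
        unfolding exp_add[symmetric] by (simp add: mult.commute)
      also have "\<dots> \<le> (fact 1 / (3 * c / 8) ^ 1 * y ^ 1) * exp (- a * \<theta>\<^sup>2)"
        using c y by (intro mult_right_mono exp_neg_inverse_le) auto
      also have "\<dots> \<le> (C2 * y) * exp (- a * \<theta>\<^sup>2)"
      proof (rule mult_right_mono)
        have "8 / (3 * c) * y \<le> C2 * y" using C1 y by (intro mult_right_mono) (auto simp: C2_def)
        then show "fact 1 / (3 * c / 8) ^ 1 * y ^ 1 \<le> C2 * y" by simp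
      qed simp
      finally show ?thesis .
    qed
    have cont: "continuous_on {-pi..pi} (\<lambda>\<theta>. Re (exp (saddle_phase s t y \<theta>)))"
      by (intro continuous_intros continuous_saddle_phase y)
    have "\<bar>saddle_integral s t y - sqrt (2 * pi / S2)\<bar> \<le> C2 * y * sqrt (pi / a) + 2 * pi * (D * y ^ 3)"
      unfolding saddle_integral_def
      using C2 D y by (intro laplace_integral_bound cont S2pos a inside outside) auto
    also have "sqrt (pi / a) = sqrt (8 * pi / c) * sqrt (y ^ 3)"
      using c y by (simp add: a_def real_sqrt_mult[symmetric])
    also have "y ^ 3 \<le> y * sqrt (y ^ 3)"
    proof -
      have "y ^ 3 \<le> y ^ 2" using y by (intro power_decreasing) auto
      then have "sqrt (y ^ 3) \<le> sqrt (y ^ 2)" by (rule real_sqrt_le_mono)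
      then have "sqrt (y ^ 3) * sqrt (y ^ 3) \<le> y * sqrt (y ^ 3)" using y by (intro mult_right_mono) auto
      then show ?thesis using y by simp
    qed
    then have "C2 * y * (sqrt (8 * pi / c) * sqrt (y ^ 3)) + 2 * pi * (D * y ^ 3)
       \<le> C2 * y * (sqrt (8 * pi / c) * sqrt (y ^ 3)) + 2 * pi * (D * (y * sqrt (y ^ 3)))"
      using D by (intro add_left_mono mult_left_mono) auto
    finally show "\<bar>saddle_integral s t y - sqrt (2 * pi / moment 2 s t y)\<bar>
       \<le> (C2 * sqrt (8 * pi / c) + 2 * pi * D) * (y * sqrt (y ^ 3))"
      by (simp add: S2_def algebra_simps)
  qed
qed

text \<open>The Gaussian main term has the order \<open>sqrt (y ^ 3)\<close>, by the upper bound for the second moment; this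
  turns the absolute error into a relative error of order \<open>y\<close>. For \<open>y > 1 / 200\<close> an error of order \<open>y\<close>
  only requires boundedness, which follows from the trivial bound \<open>2 * \<pi>\<close> for the integral.\<close>

lemma saddle_integral_relative:
  "\<exists>C>0. \<forall>N y s t. 0 < y \<longrightarrow> s \<ge> 10 \<longrightarrow> t \<ge> 10 \<longrightarrow> moment 1 s t y = real N \<longrightarrow>
     \<bar>saddle_integral s t y / sqrt (2 * pi / moment 2 s t y) - 1\<bar> \<le> C * y"
proof -
  obtain C where C: "C > 0" "\<And>y s t. 0 < y \<Longrightarrow> y \<le> 1 / 200 \<Longrightarrow> s \<ge> 10 \<Longrightarrow> t \<ge> 10 \<Longrightarrow>
     \<bar>saddle_integral s t y - sqrt (2 * pi / moment 2 s t y)\<bar> \<le> C * (y * sqrt (y ^ 3))"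
    using saddle_integral_asymptotics by blast
  define K :: real where "K = 8 / pi ^ 3"
  have K: "K > 0" by (simp add: K_def)
  define C1 where "C1 = C * sqrt (K / (2 * pi))"
  \<comment> \<open>the factor \<open>200\<close> converts the constant bound, valid for \<open>y > 1 / 200\<close>, into a multiple of \<open>y\<close>\<close>
  define C2 where "C2 = 200 * (2 * pi * sqrt (K * 200 ^ 3 / (2 * pi)) + 1)"
  have C12: "C1 > 0" "C2 > 0" using C K by (auto simp: C1_def C2_def intro!: add_pos_pos mult_pos_pos)
  show ?thesis
  proof (intro exI[of _ "C1 + C2"] conjI allI impI)
    show "C1 + C2 > 0" using C12 by simp
    fix N s t :: nat and y :: real
    assume y: "0 < y" and st: "s \<ge> 10" "t \<ge> 10" and N: "moment 1 s t y = real N"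
    define S2 I G where "S2 = moment 2 s t y" and "I = saddle_integral s t y" and "G = sqrt (2 * pi / S2)"
    have S2: "S2 > 0" using moment_pos[of y s t 2] y st by (simp add: S2_def)
    have G: "G > 0" using S2 by (simp add: G_def)
    have G1: "1 / G = sqrt (S2 / (2 * pi))" using S2 by (simp add: G_def real_sqrt_divide)
    have "S2 \<le> 4 * fact 2 / (pi * y) ^ Suc 2" unfolding S2_def by (rule moment_le[OF y])
    then have S2K: "S2 \<le> K / y ^ 3" by (simp add: K_def power_mult_distrib)
    have "\<bar>I / G - 1\<bar> \<le> C1 * y \<or> \<bar>I / G - 1\<bar> \<le> C2 * y"
    proof (cases "y \<le> 1 / 200")
      case True
      have "I / G - 1 = (I - G) * (1 / G)" using G by (simp add: field_simps)
      then have "\<bar>I / G - 1\<bar> = \<bar>I - G\<bar> * (1 / G)" using G by (simp add: abs_mult)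
      also have "\<dots> \<le> C * (y * sqrt (y ^ 3)) * (1 / G)"
        using C(2)[OF y True st] G by (intro mult_right_mono) (auto simp: I_def G_def S2_def)
      also have "\<dots> = C * y * sqrt (y ^ 3 * (S2 / (2 * pi)))"
        unfolding G1 real_sqrt_mult by simp
      also have "\<dots> \<le> C * y * sqrt (K / (2 * pi))"
      proof -
        have "y ^ 3 * S2 \<le> K" using S2K y by (simp add: field_simps)
        then have "y ^ 3 * (S2 / (2 * pi)) \<le> K / (2 * pi)" by (simp add: field_simps)
        then show ?thesis using C y by (intro mult_left_mono real_sqrt_le_mono) auto
      qed
      finally show ?thesis by (simp add: C1_def mult_ac)
    next
      case False
      have I: "0 \<le> I" "I \<le> 2 * pi" unfolding I_def using saddle_integral_bounds[OF y N] by auto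
      have "1 / y \<le> 200" using False y by (simp add: field_simps)
      then have "(1 / y) ^ 3 \<le> 200 ^ 3" using y by (intro power_mono) auto
      then have "K * (1 / y) ^ 3 \<le> K * 200 ^ 3" using K by (intro mult_left_mono) auto
      then have "S2 \<le> K * 200 ^ 3" using S2K by (simp add: power_divide)
      then have "1 / G \<le> sqrt (K * 200 ^ 3 / (2 * pi))"
        unfolding G1 by (intro real_sqrt_le_mono divide_right_mono) auto
      then have "I * (1 / G) \<le> 2 * pi * sqrt (K * 200 ^ 3 / (2 * pi))"
        using I G by (intro mult_mono) auto
      moreover have "0 \<le> I / G" using I G by simp
      ultimately have "\<bar>I / G - 1\<bar> \<le> 2 * pi * sqrt (K * 200 ^ 3 / (2 * pi)) + 1" by simp
      also have "\<dots> = C2 * (1 / 200)" by (simp add: C2_def)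
      also have "\<dots> \<le> C2 * y" using False C12 by (intro mult_left_mono) auto
      finally show ?thesis by simp
    qed
    moreover have "C1 * y \<le> (C1 + C2) * y" "C2 * y \<le> (C1 + C2) * y"
      using C12 y by (auto simp: distrib_right)
    ultimately show "\<bar>saddle_integral s t y / sqrt (2 * pi / moment 2 s t y) - 1\<bar> \<le> (C1 + C2) * y"
      unfolding I_def G_def S2_def by linarith
  qed
qed

lemma saddle_equation_iff:
  assumes "coprime s t" "s > 0" "t > 0" "y > 0"
  shows "- b 1 s t y / complex_of_real (real (2 * s * t) * y\<^sup>2) = of_nat N \<longleftrightarrow> moment 1 s t y = real N"
proof -
  have "- b 1 s t y / complex_of_real (real (2 * s * t) * y\<^sup>2) = of_real (moment 1 s t y)"
    unfolding b_1_eq[OF assms] using assms by simp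
  moreover have "(of_nat N :: complex) = of_real (real N)" by simp
  ultimately show ?thesis by (simp only: of_real_eq_iff)
qed

theorem theorem1p1:
  shows
    "(\<forall>(N :: nat) (s :: nat) (t :: nat). N > 0 \<longrightarrow> t \<ge> 10 \<longrightarrow> s > t \<longrightarrow> coprime s t \<longrightarrow>
        (\<exists>!y :: real. y > 0 \<and> - b 1 s t y / (2 * s * t * y\<^sup>2) = of_nat N))
   \<and> (\<exists>C :: real. C > 0 \<and>
        (\<forall>(N :: nat) (s :: nat) (t :: nat) (y :: real).
           N > 0 \<longrightarrow> t \<ge> 10 \<longrightarrow> s > t \<longrightarrow> coprime s t \<longrightarrow>
           y > 0 \<longrightarrow> - b 1 s t y / (2 * s * t * y\<^sup>2) = of_nat N \<longrightarrow>
           (\<exists>\<epsilon> :: complex. norm \<epsilon> \<le> C * y \<and>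
              of_nat (pbar s t N) =
                (y powr (3 / 2) * sqrt (2 * s * t) * exp (2 * pi * N * y) * H (\<i> * y) s t)
                / csqrt (b 2 s t y) * (1 + \<epsilon>))))"
proof (intro conjI allI impI)
  fix N s t :: nat
  assume st: "N > 0" "t \<ge> 10" "s > t" "coprime s t"
  have eq: "(y > 0 \<and> - b 1 s t y / complex_of_real (real (2 * s * t) * y\<^sup>2) = of_nat N)
      = (y > 0 \<and> moment 1 s t y = real N)" for y :: real
  proof (rule conj_cong[OF refl])
    assume "y > 0"
    with st show "(- b 1 s t y / complex_of_real (real (2 * s * t) * y\<^sup>2) = of_nat N) = (moment 1 s t y = real N)"
      by (intro saddle_equation_iff) auto
  qed
  show "\<exists>!y :: real. y > 0 \<and> - b 1 s t y / (2 * s * t * y\<^sup>2) = of_nat N"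
    unfolding eq using st by (intro ex1_saddle_point) auto
next
  obtain C where C: "C > 0" "\<And>N y s t. 0 < y \<Longrightarrow> s \<ge> 10 \<Longrightarrow> t \<ge> 10 \<Longrightarrow> moment 1 s t y = real N \<Longrightarrow>
     \<bar>saddle_integral s t y / sqrt (2 * pi / moment 2 s t y) - 1\<bar> \<le> C * y"
    using saddle_integral_relative by blast
  have main: "\<exists>\<epsilon> :: complex. norm \<epsilon> \<le> C * y \<and>
              of_nat (pbar s t N) =
                (y powr (3 / 2) * sqrt (2 * s * t) * exp (2 * pi * N * y) * H (\<i> * y) s t)
                / csqrt (b 2 s t y) * (1 + \<epsilon>)"
    if st: "t \<ge> 10" "s > t" "coprime s t" and y: "y > 0"
      and eq: "- b 1 s t y / (2 * s * t * y\<^sup>2) = of_nat N" for N s t :: nat and y :: real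
  proof -
    have pos: "s > 0" "t > 0" using st by auto
    have N: "moment 1 s t y = real N" using eq by (simp only: saddle_equation_iff[OF st(3) pos y])
    define S2 I G E where "S2 = moment 2 s t y" and "I = saddle_integral s t y" and "G = sqrt (2 * pi / S2)"
      and "E = exp (moment 0 s t y)"
    have S2: "S2 > 0" using moment_pos[of y s t 2] y st by (simp add: S2_def)
    have G: "G > 0" using S2 by (simp add: G_def)
    have I: "I = 2 * pi * real (pbar s t N) * exp (- 2 * pi * y) ^ N / E"
      unfolding I_def E_def by (rule saddle_integral_eq[OF y N])
    define \<epsilon> where "\<epsilon> = I / G - 1"
    have \<epsilon>: "\<bar>\<epsilon>\<bar> \<le> C * y"
      unfolding \<epsilon>_def I_def G_def S2_def using st y N by (intro C(2)) auto
    have Q: "sqrt (4 * pi * real s * real t * y ^ 3 * S2) = sqrt (2 * real s * real t) * sqrt (y ^ 3) * sqrt (2 * pi * S2)"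
      unfolding real_sqrt_mult[symmetric] by (simp add: mult_ac)
    have csq: "csqrt (b 2 s t y) = of_real (sqrt (2 * real s * real t) * sqrt (y ^ 3) * sqrt (2 * pi * S2))"
      unfolding b_2_eq[OF st(3) pos y] S2_def[symmetric] Q[symmetric]
      using S2 y by (subst of_real_sqrt) auto
    have yp: "y powr (3 / 2) = sqrt (y ^ 3)"
      using y by (simp add: powr_half_sqrt[symmetric] powr_powr flip: powr_numeral)
    have "y powr (3 / 2) * sqrt (2 * s * t) * exp (2 * pi * N * y) * E
       / (sqrt (2 * real s * real t) * sqrt (y ^ 3) * sqrt (2 * pi * S2)) * (1 + \<epsilon>) = real (pbar s t N)"
    proof -
      have "sqrt (2 * pi * S2) * G = 2 * pi"
      proof -
        have "2 * pi * S2 * (2 * pi / S2) = (2 * pi)\<^sup>2" using S2 by (simp add: power2_eq_square)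
        then show ?thesis unfolding G_def real_sqrt_mult[symmetric] by (simp only: real_sqrt_abs) simp
      qed
      have ex: "exp (2 * pi * N * y) * exp (- 2 * pi * y) ^ N = 1"
        by (simp add: exp_of_nat_mult[symmetric] mult_ac flip: exp_add)
      have "y powr (3 / 2) * sqrt (2 * s * t) * exp (2 * pi * N * y) * E
         / (sqrt (2 * real s * real t) * sqrt (y ^ 3) * sqrt (2 * pi * S2)) * (1 + \<epsilon>)
         = exp (2 * pi * N * y) * E / sqrt (2 * pi * S2) * (I / G)"
        unfolding yp \<epsilon>_def using y pos by simp
      also have "\<dots> = exp (2 * pi * N * y) * E * I / (sqrt (2 * pi * S2) * G)" by simp
      also have "\<dots> = exp (2 * pi * N * y) * E * I / (2 * pi)" by (simp only: \<open>sqrt (2 * pi * S2) * G = 2 * pi\<close>)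
      also have "\<dots> = real (pbar s t N) * (exp (2 * pi * N * y) * exp (- 2 * pi * y) ^ N)"
        unfolding I by (simp add: E_def)
      finally show ?thesis unfolding ex by simp
    qed
    then have "of_nat (pbar s t N) = complex_of_real (y powr (3 / 2) * sqrt (2 * s * t) * exp (2 * pi * N * y) * E
       / (sqrt (2 * real s * real t) * sqrt (y ^ 3) * sqrt (2 * pi * S2)) * (1 + \<epsilon>))"
      by simp
    also have "\<dots> = (y powr (3 / 2) * sqrt (2 * s * t) * exp (2 * pi * N * y) * H (\<i> * y) s t)
                / csqrt (b 2 s t y) * (1 + complex_of_real \<epsilon>)"
      unfolding csq H_imaginary_axis[OF st(3) pos y] E_def[symmetric] by simp
    finally show ?thesis using \<epsilon> by (intro exI[of _ "complex_of_real \<epsilon>"]) auto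
  qed
  show "\<exists>C :: real. C > 0 \<and>
        (\<forall>(N :: nat) (s :: nat) (t :: nat) (y :: real).
           N > 0 \<longrightarrow> t \<ge> 10 \<longrightarrow> s > t \<longrightarrow> coprime s t \<longrightarrow>
           y > 0 \<longrightarrow> - b 1 s t y / (2 * s * t * y\<^sup>2) = of_nat N \<longrightarrow>
           (\<exists>\<epsilon> :: complex. norm \<epsilon> \<le> C * y \<and>
              of_nat (pbar s t N) =
                (y powr (3 / 2) * sqrt (2 * s * t) * exp (2 * pi * N * y) * H (\<i> * y) s t)
                / csqrt (b 2 s t y) * (1 + \<epsilon>)))"
    using C(1) main by (intro exI[of _ C] conjI allI impI) auto
qed

end
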